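(* Let $P$ be a convex pentagon with interior angles $A, B, C, D, E$ (in degrees) at its five corners. Suppose $P$ admits a periodic monohedral tiling of the plane, i.e. there is a tiling of the Euclidean plane by congruent copies of $P$ that is periodic. Then some three of the interior angles of $P$, chosen with repetition allowed, sum to $360^\circ$. That is, there exist $X, Y, Z \in \{A, B, C, D, E\}$, not necessarily distinct, with $X+Y+Z = 360^\circ$. Equivalently, at least one of the following 35 relations holds: - $\alpha+\beta+\gamma=360^\circ$ for three distinct angles $\alpha,\beta,\gamma\in\{A,B,C,D,E\}$; - $2\alpha+\beta=360^\circ$ for two distinct angles $\alpha,\beta\in\{A,B,C,D,E\}$; - $3\alpha=360^\circ$ for some $\alpha\in\{A,B,C,D,E\}$.
   Context: A tiling of the plane is a countable collection of closed sets (tiles) covering the plane such that distinct tiles have disjoint interiors. A tiling is monohedral if all tiles are congruent to a single shape; a convex pentagon admitting such a tiling is a convex pentagonal tile. Congruent copies may include reflected copies. The tiling is not required to be edge-to-edge. A tiling is periodic if it is mapped onto itself by translations in two nonparallel directions, i.e. it is invariant under translation by two linearly independent vectors. *)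

theory Defs
  imports "HOL-Analysis.Analysis"
begin

definition cross2 :: "real^2 \<Rightarrow> real^2 \<Rightarrow> real" where
  "cross2 a b = a$1 * b$2 - a$2 * b$1"

text \<open>A convex pentagon given by its corners p 0, ..., p 4 in cyclic order
  (indices taken mod 5): for every edge from p i to p (i+1), all three remaining
  corners lie strictly on the same side of the line through that edge
  (the same side for all edges, either orientation allowed).\<close>
definition convex_pentagon :: "(nat \<Rightarrow> real^2) \<Rightarrow> bool" where
  "convex_pentagon p \<longleftrightarrow>
     (\<forall>i<5. \<forall>j<5. j \<noteq> i \<and> j \<noteq> (i+1) mod 5 \<longrightarrow>
         cross2 (p ((i+1) mod 5) - p i) (p j - p i) > 0) \<or>
     (\<forall>i<5. \<forall>j<5. j \<noteq> i \<and> j \<noteq> (i+1) mod 5 \<longrightarrow>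
         cross2 (p ((i+1) mod 5) - p i) (p j - p i) < 0)"

definition pentagon_region :: "(nat \<Rightarrow> real^2) \<Rightarrow> (real^2) set" where
  "pentagon_region p = convex hull (p ` {..<5})"

definition interior_angle_deg :: "(nat \<Rightarrow> real^2) \<Rightarrow> nat \<Rightarrow> real" where
  "interior_angle_deg p i =
     (let a = p ((i+4) mod 5) - p i; b = p ((i+1) mod 5) - p i
      in arccos ((a \<bullet> b) / (norm a * norm b)) * 180 / pi)"

definition isometry2 :: "(real^2 \<Rightarrow> real^2) \<Rightarrow> bool" where
  "isometry2 f \<longleftrightarrow> (\<forall>x y. dist (f x) (f y) = dist x y)"

definition congruent2 :: "(real^2) set \<Rightarrow> (real^2) set \<Rightarrow> bool" where
  "congruent2 S T \<longleftrightarrow> (\<exists>f. isometry2 f \<and> f ` S = T)"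

definition tiling :: "(real^2) set set \<Rightarrow> bool" where
  "tiling T \<longleftrightarrow> countable T \<and> (\<forall>X\<in>T. closed X) \<and> \<Union>T = UNIV \<and>
     (\<forall>X\<in>T. \<forall>Y\<in>T. X \<noteq> Y \<longrightarrow> interior X \<inter> interior Y = {})"

definition monohedral_tiling_by :: "(real^2) set \<Rightarrow> (real^2) set set \<Rightarrow> bool" where
  "monohedral_tiling_by P T \<longleftrightarrow> tiling T \<and> (\<forall>X\<in>T. congruent2 P X)"

definition periodic_tiling :: "(real^2) set set \<Rightarrow> bool" where
  "periodic_tiling T \<longleftrightarrow> (\<exists>u v. u \<noteq> v \<and> independent {u, v} \<and>
     (\<lambda>X. (\<lambda>x. x + u) ` X) ` T = T \<and> (\<lambda>X. (\<lambda>x. x + v) ` X) ` T = T)"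

end

theory Submission
  imports Defs
begin

text \<open>
  Give each corner of each tile the weight (angle \<open>- pi / 2\<close>). The five weights of a tile add up to
  \<open>3 * pi - 5 * pi / 2 > 0\<close>. If every tile through a point has a corner there, the angles at the
  point sum to \<open>2 * pi\<close>, so at least three corners meet. Otherwise some tile through it takes up
  an angle of at least \<open>pi\<close>, and if any corners meet there, then at least two do, with sum at most
  \<open>pi\<close>. Hence the weights at a point have a positive sum only when exactly three corners with sum
  \<open>2 * pi\<close> meet there. If this never happened, counting the total weight modulo the period lattice
  by tiles and by points would give a contradiction.

  Additivity of angles at a point comes from measuring a cone by the Lebesgue measure of the
  parameters \<open>t\<close> in \<open>[0, 2 * pi)\<close> with \<open>(cos t, sin t)\<close> in the cone: the tangent cones of the tiles
  at a point cover the plane, and any two of them overlap in a subset of a line.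
\<close>

section \<open>Angles between vectors and the angle sum of a pentagon\<close>

definition angle_between :: "real^2 \<Rightarrow> real^2 \<Rightarrow> real" where
  "angle_between a b = arccos ((a \<bullet> b) / (norm a * norm b))"

lemma angle_between_commute: "angle_between a b = angle_between b a"
  by (simp add: angle_between_def inner_commute mult.commute)

lemma inner2: "(a::real^2) \<bullet> b = a$1 * b$1 + a$2 * b$2"
  by (simp add: inner_vec_def sum_2)

lemma cross2_simps:
  "cross2 (a + b) c = cross2 a c + cross2 b c" "cross2 a (b + c) = cross2 a b + cross2 a c"
  "cross2 (a - b) c = cross2 a c - cross2 b c" "cross2 a (b - c) = cross2 a b - cross2 a c"
  "cross2 (r *\<^sub>R a) b = r * cross2 a b" "cross2 a (r *\<^sub>R b) = r * cross2 a b"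
  "cross2 (- a) b = - cross2 a b" "cross2 a (- b) = - cross2 a b"
  "cross2 a a = 0" "cross2 0 a = 0" "cross2 a 0 = 0"
  by (simp_all add: cross2_def algebra_simps)

lemma cross2_swap: "cross2 b a = - cross2 a b"
  by (simp add: cross2_def)

text \<open>Cramer's rule in the plane, multiplied out so that parallel \<open>a\<close> and
  \<open>b\<close> are allowed.\<close>

lemma cross2_decompose: "cross2 a b *\<^sub>R d = cross2 d b *\<^sub>R a + cross2 a d *\<^sub>R b"
  by (simp add: vec_eq_iff forall_2 cross2_def algebra_simps)

text \<open>Lagrange's identity. It yields the sine of an angle and, later, the determinant of an
  isometry up to sign.\<close>

lemma cross2_square_add_inner_square:
  "(cross2 a b)\<^sup>2 + (a \<bullet> b)\<^sup>2 = (norm a * norm b)\<^sup>2"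
  unfolding power_mult_distrib power2_norm_eq_inner
  by (simp add: cross2_def inner2 power2_eq_square algebra_simps)

lemma abs_cosine_le_1: "\<bar>(a \<bullet> b) / (norm a * norm b)\<bar> \<le> 1"
proof -
  have "\<bar>(a \<bullet> b) / (norm a * norm b)\<bar> = \<bar>a \<bullet> b\<bar> / (norm a * norm b)"
    by (simp add: abs_mult)
  also have "\<dots> \<le> 1"
    using Cauchy_Schwarz_ineq2[of a b] by (intro divide_le_eq_1[THEN iffD2]) (auto simp: less_eq_real_def)
  finally show ?thesis .
qed

lemma cos_angle_between:
  "cos (angle_between a b) = (a \<bullet> b) / (norm a * norm b)"
proof -
  have "\<bar>(a \<bullet> b) / (norm a * norm b)\<bar> \<le> 1"
    by (rule abs_cosine_le_1)
  then show ?thesis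
    unfolding angle_between_def by (simp add: cos_arccos_abs)
qed

lemma angle_between_bounds: "0 \<le> angle_between a b" "angle_between a b \<le> pi"
proof -
  have "\<bar>(a \<bullet> b) / (norm a * norm b)\<bar> \<le> 1"
    by (rule abs_cosine_le_1)
  then show "0 \<le> angle_between a b" "angle_between a b \<le> pi"
    unfolding angle_between_def abs_le_iff by (auto intro: arccos_lbound arccos_ubound)
qed

lemma sin_angle_between:
  assumes "a \<noteq> 0" "b \<noteq> 0"
  shows "sin (angle_between a b) = \<bar>cross2 a b\<bar> / (norm a * norm b)"
proof -
  have n: "norm a * norm b > 0" using assms by simp
  have "(sin (angle_between a b))\<^sup>2 = 1 - ((a \<bullet> b) / (norm a * norm b))\<^sup>2"
    using cos_angle_between[of a b] sin_cos_squared_add[of "angle_between a b"] by simp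
  also have "\<dots> = ((norm a * norm b)\<^sup>2 - (a \<bullet> b)\<^sup>2) / (norm a * norm b)\<^sup>2"
    using assms by (simp add: power_divide diff_divide_distrib)
  also have "\<dots> = (cross2 a b / (norm a * norm b))\<^sup>2"
    by (simp add: power_divide flip: cross2_square_add_inner_square)
  finally have "\<bar>sin (angle_between a b)\<bar> = \<bar>cross2 a b / (norm a * norm b)\<bar>"
    by (metis real_sqrt_abs)
  moreover have "sin (angle_between a b) \<ge> 0"
    using angle_between_bounds by (intro sin_ge_zero) auto
  ultimately show ?thesis using n by (simp add: abs_mult)
qed

lemma cross2_nonzeroD: "cross2 a b \<noteq> 0 \<Longrightarrow> a \<noteq> 0 \<and> b \<noteq> 0"
  by (auto simp: cross2_simps)

lemma angle_between_strict_bounds: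
  assumes "cross2 a b \<noteq> 0"
  shows "0 < angle_between a b" "angle_between a b < pi"
proof -
  have "sin (angle_between a b) \<noteq> 0"
    using sin_angle_between[of a b] cross2_nonzeroD[OF assms] assms by simp
  then have "angle_between a b \<noteq> 0" "angle_between a b \<noteq> pi" by auto
  then show "0 < angle_between a b" "angle_between a b < pi"
    using angle_between_bounds[of a b] by auto
qed

text \<open>The addition formulas and two polynomial identities give sine and cosine of the sum. The
  sine is positive, which places the sum below \<open>pi\<close>, where \<open>arccos\<close>
  inverts the cosine.\<close>

lemma angle_between_add_pos:
  assumes "cross2 a c > 0" "cross2 c b > 0" "cross2 a b > 0"
  shows "angle_between a b = angle_between a c + angle_between c b"
proof -
  let ?f = "angle_between a c" and ?g = "angle_between c b"
  have nz: "a \<noteq> 0" "b \<noteq> 0" "c \<noteq> 0"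
    using cross2_nonzeroD assms by (metis less_irrefl)+
  have bd: "0 < ?f" "?f < pi" "0 < ?g" "?g < pi"
    using angle_between_strict_bounds assms by auto
  have n: "norm a > 0" "norm b > 0" "norm c > 0" using nz by auto
  have cc: "c \<bullet> c = norm c * norm c" by (simp add: dot_square_norm power2_eq_square)
  have "cross2 a c * (c \<bullet> b) + (a \<bullet> c) * cross2 c b = cross2 a b * (c \<bullet> c)"
    by (simp add: cross2_def inner2 algebra_simps)
  then have "sin (?f + ?g) = cross2 a b / (norm a * norm b)"
    using n assms by (simp add: sin_add sin_angle_between cos_angle_between nz cc field_simps)
  then have "sin (?f + ?g) > 0" using n assms by simp
  then have lt: "?f + ?g < pi"
    using bd sin_le_zero[of "?f + ?g"] by force
  have "(a \<bullet> c) * (c \<bullet> b) - cross2 a c * cross2 c b = (a \<bullet> b) * (c \<bullet> c)"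
    by (simp add: cross2_def inner2 algebra_simps)
  then have "cos (?f + ?g) = (a \<bullet> b) / (norm a * norm b)"
    using n assms by (simp add: cos_add sin_angle_between cos_angle_between nz cc field_simps)
  then show ?thesis
    using lt bd by (metis angle_between_def arccos_cos add_pos_pos less_imp_le)
qed

text \<open>The factor \<open>s\<close> stands for either orientation; a negative one is handled by
  exchanging \<open>a\<close> and \<open>b\<close>.\<close>

lemma angle_between_add:
  assumes "s * cross2 a c > 0" "s * cross2 c b > 0" "s * cross2 a b > 0"
  shows "angle_between a b = angle_between a c + angle_between c b"
proof (cases "s > 0")
  case True
  then show ?thesis using assms by (intro angle_between_add_pos) (auto simp: zero_less_mult_iff)
next
  case False
  then have "angle_between b a = angle_between b c + angle_between c a"
    using assms
    by (intro angle_between_add_pos) (auto simp: zero_less_mult_iff cross2_def mult.commute)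
  then show ?thesis by (simp add: angle_between_commute add.commute)
qed

section \<open>Angle sums of triangles and convex pentagons\<close>

lemma angle_between_minus:
  "angle_between a (- b) = pi - angle_between a b"
  "angle_between (- a) (- b) = angle_between a b"
proof -
  have "\<bar>(a \<bullet> b) / (norm a * norm b)\<bar> \<le> 1"
    by (rule abs_cosine_le_1)
  then show "angle_between a (- b) = pi - angle_between a b"
    unfolding angle_between_def abs_le_iff
    using arccos_minus[of "(a \<bullet> b) / (norm a * norm b)"] by simp
  show "angle_between (- a) (- b) = angle_between a b"
    by (simp add: angle_between_def)
qed

text \<open>The exterior angle at \<open>b\<close>, between \<open>b - a\<close> and
  \<open>c - b\<close>, is split by \<open>c - a\<close> into the angles at \<open>a\<close> and
  \<open>c\<close>.\<close>

lemma triangle_angle_sum: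
  assumes "s * cross2 (b - a) (c - a) > 0"
  shows "angle_between (b - a) (c - a) + angle_between (c - b) (a - b)
       + angle_between (a - c) (b - c) = pi"
proof -
  have "angle_between (b - a) (c - b) = angle_between (b - a) (c - a) + angle_between (c - a) (c - b)"
    by (rule angle_between_add[of s]) (use assms in \<open>simp_all add: cross2_def algebra_simps\<close>)
  moreover have "angle_between (c - b) (a - b) = pi - angle_between (c - b) (b - a)"
    using angle_between_minus(1)[of "c - b" "b - a"] by simp
  moreover have "angle_between (a - c) (b - c) = angle_between (c - a) (c - b)"
    using angle_between_minus(2)[of "c - a" "c - b"] by simp
  ultimately show ?thesis by (simp add: angle_between_commute)
qed

text \<open>Both orientations in one formula. The factor is an arbitrary real, so that the
  determinant of an isometry can later be multiplied into it.\<close>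

definition oriented_pentagon :: "real \<Rightarrow> (nat \<Rightarrow> real^2) \<Rightarrow> bool" where
  "oriented_pentagon s p \<longleftrightarrow> (\<forall>i<5. \<forall>j<5. j \<noteq> i \<and> j \<noteq> (i+1) mod 5 \<longrightarrow>
         s * cross2 (p ((i+1) mod 5) - p i) (p j - p i) > 0)"

lemma convex_pentagon_imp_oriented:
  assumes "convex_pentagon p"
  obtains s where "oriented_pentagon s p"
proof -
  have "oriented_pentagon 1 p \<or> oriented_pentagon (-1) p"
    using assms by (simp add: convex_pentagon_def oriented_pentagon_def)
  then show ?thesis using that by blast
qed

definition corner_angle :: "(nat \<Rightarrow> real^2) \<Rightarrow> nat \<Rightarrow> real" where
  "corner_angle p i = angle_between (p ((i+4) mod 5) - p i) (p ((i+1) mod 5) - p i)"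

lemma interior_angle_deg_eq: "interior_angle_deg p i = corner_angle p i * 180 / pi"
  by (simp add: interior_angle_deg_def corner_angle_def angle_between_def Let_def)

text \<open>The diagonals from corner 0 cut the pentagon into three triangles. They split the angle
  at corner 0 into three parts and those at corners 2 and 3 into two each.\<close>

lemma pentagon_angle_sum:
  assumes "oriented_pentagon s p"
  shows "(\<Sum>i<5. corner_angle p i) = 3 * pi"
proof -
  have c: "s * cross2 (p ((i+1) mod 5) - p i) (p j - p i) > 0"
    if "i<5" "j<5" "j \<noteq> i" "j \<noteq> (i+1) mod 5" for i j
    using assms that by (auto simp: oriented_pentagon_def)
  note cs = c[of 0 2] c[of 0 3] c[of 0 4] c[of 1 3] c[of 1 4] c[of 1 0]
    c[of 2 4] c[of 2 0] c[of 2 1] c[of 3 0] c[of 3 1] c[of 3 2] c[of 4 1] c[of 4 2] c[of 4 3]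
  have u: "(\<Sum>i<5. corner_angle p i) = corner_angle p 0 + corner_angle p 1
      + corner_angle p 2 + corner_angle p 3 + corner_angle p 4"
    by (simp add: eval_nat_numeral)
  have t1: "angle_between (p 1 - p 0) (p 2 - p 0) + angle_between (p 2 - p 1) (p 0 - p 1)
       + angle_between (p 0 - p 2) (p 1 - p 2) = pi"
    by (rule triangle_angle_sum[of s]) (use cs in \<open>simp add: cross2_def algebra_simps\<close>)
  have t2: "angle_between (p 2 - p 0) (p 3 - p 0) + angle_between (p 3 - p 2) (p 0 - p 2)
       + angle_between (p 0 - p 3) (p 2 - p 3) = pi"
    by (rule triangle_angle_sum[of s]) (use cs in \<open>simp add: cross2_def algebra_simps\<close>)
  have t3: "angle_between (p 3 - p 0) (p 4 - p 0) + angle_between (p 4 - p 3) (p 0 - p 3)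
       + angle_between (p 0 - p 4) (p 3 - p 4) = pi"
    by (rule triangle_angle_sum[of s]) (use cs in \<open>simp add: cross2_def algebra_simps\<close>)
  have a0: "angle_between (p 1 - p 0) (p 4 - p 0) =
      angle_between (p 1 - p 0) (p 2 - p 0) + angle_between (p 2 - p 0) (p 4 - p 0)"
    by (rule angle_between_add[of s]) (use cs in \<open>simp_all add: cross2_def algebra_simps\<close>)
  have a0': "angle_between (p 2 - p 0) (p 4 - p 0) =
      angle_between (p 2 - p 0) (p 3 - p 0) + angle_between (p 3 - p 0) (p 4 - p 0)"
    by (rule angle_between_add[of s]) (use cs in \<open>simp_all add: cross2_def algebra_simps\<close>)
  have a2: "angle_between (p 3 - p 2) (p 1 - p 2) =
      angle_between (p 3 - p 2) (p 0 - p 2) + angle_between (p 0 - p 2) (p 1 - p 2)"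
    by (rule angle_between_add[of s]) (use cs in \<open>simp_all add: cross2_def algebra_simps\<close>)
  have a3: "angle_between (p 4 - p 3) (p 2 - p 3) =
      angle_between (p 4 - p 3) (p 0 - p 3) + angle_between (p 0 - p 3) (p 2 - p 3)"
    by (rule angle_between_add[of s]) (use cs in \<open>simp_all add: cross2_def algebra_simps\<close>)
  show ?thesis
    unfolding u using t1 t2 t3 a0 a0' a2 a3
    by (simp add: corner_angle_def angle_between_commute numeral_2_eq_2)
qed

section \<open>Angular measure of planar cones\<close>

definition direction :: "real \<Rightarrow> real^2" where
  "direction t = vector [cos t, sin t]"

definition directions_in :: "(real^2) set \<Rightarrow> real set" where
  "directions_in K = {t. 0 \<le> t \<and> t < 2 * pi \<and> direction t \<in> K}"

definition cone_angle :: "(real^2) set \<Rightarrow> real" where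
  "cone_angle K = measure lebesgue (directions_in K)"

definition wedge :: "real^2 \<Rightarrow> real^2 \<Rightarrow> (real^2) set" where
  "wedge a b = {x *\<^sub>R a + y *\<^sub>R b | x y. 0 \<le> x \<and> 0 \<le> y}"

definition half_plane :: "real^2 \<Rightarrow> (real^2) set" where
  "half_plane d = {y. cross2 d y \<ge> 0}"

lemma direction_nth [simp]: "direction t $ 1 = cos t" "direction t $ 2 = sin t"
  by (simp_all add: direction_def vector_2)

lemma direction_periodic: "direction (t + 2 * pi) = direction t"
  by (simp add: vec_eq_iff forall_2)

lemma cross2_direction: "cross2 (direction s) (direction t) = sin (t - s)"
  by (simp add: cross2_def sin_diff algebra_simps)

lemma polar_form:
  fixes a :: "real^2"
  assumes "a \<noteq> 0"
  obtains t where "0 \<le> t" "t < 2 * pi" "a = norm a *\<^sub>R direction t"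
proof -
  have n: "(norm a)\<^sup>2 = (a$1)\<^sup>2 + (a$2)\<^sup>2"
    unfolding power2_norm_eq_inner by (simp add: inner2 power2_eq_square)
  have "(a$1 / norm a)\<^sup>2 + (a$2 / norm a)\<^sup>2 = ((a$1)\<^sup>2 + (a$2)\<^sup>2) / (norm a)\<^sup>2"
    by (simp add: power_divide add_divide_distrib)
  also have "\<dots> = 1" unfolding n[symmetric] using assms by simp
  finally obtain t where "0 \<le> t" "t < 2 * pi"
    and t: "a$1 / norm a = cos t" "a$2 / norm a = sin t"
    by (rule sincos_total_2pi)
  have "a = norm a *\<^sub>R direction t" using assms
    by (simp add: vec_eq_iff forall_2 flip: t)
  then show ?thesis using that \<open>0 \<le> t\<close> \<open>t < 2 * pi\<close> by blast
qed

text \<open>The arc is allowed to wrap around \<open>2 * pi\<close>.\<close>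

lemma cone_angle_arc:
  assumes a: "0 \<le> a" "a < 2 * pi" and g: "0 \<le> g" "g < 2 * pi"
    and K: "\<And>s. 0 \<le> s \<Longrightarrow> s < 2 * pi \<Longrightarrow> direction (a + s) \<in> K \<longleftrightarrow> s \<le> g"
  shows "directions_in K \<in> lmeasurable \<and> cone_angle K = g"
proof -
  have 1: "direction t \<in> K \<longleftrightarrow> t \<le> a + g" if "a \<le> t" "t < 2 * pi" for t
    using K[of "t - a"] that a by auto
  \<comment> \<open>Parameters below \<open>a\<close> are reached only after the arc passes
    \<open>2 * pi\<close>, hence the added full turn.\<close>
  have 2: "direction t \<in> K \<longleftrightarrow> t + 2 * pi \<le> a + g" if "0 \<le> t" "t < a" for t
    using K[of "t - a + 2 * pi"] that a direction_periodic[of t] by (auto simp: algebra_simps)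
  show ?thesis
  proof (cases "a + g < 2 * pi")
    case True
    have "directions_in K = {a..a + g}"
    proof (intro set_eqI iffI)
      fix t assume "t \<in> directions_in K"
      then show "t \<in> {a..a + g}" using 1[of t] 2[of t] a g True
        by (cases "t < a") (auto simp: directions_in_def)
    next
      fix t assume "t \<in> {a..a + g}"
      then show "t \<in> directions_in K" using 1[of t] a g True
        by (auto simp: directions_in_def)
    qed
    then show ?thesis using g by (simp add: cone_angle_def)
  next
    case False
    have D: "directions_in K = {a..<2 * pi} \<union> {0..a + g - 2 * pi}"
    proof (intro set_eqI iffI)
      fix t assume "t \<in> directions_in K"
      then show "t \<in> {a..<2 * pi} \<union> {0..a + g - 2 * pi}" using 2[of t]
        by (cases "t < a") (auto simp: directions_in_def)
    next
      fix t assume "t \<in> {a..<2 * pi} \<union> {0..a + g - 2 * pi}"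
      then show "t \<in> directions_in K" using 1[of t] 2[of t] a g False
        by (cases "t < a") (auto simp: directions_in_def)
    qed
    \<comment> \<open>The two pieces are disjoint: \<open>g < 2 * pi\<close> puts the end of the
      second one below \<open>a\<close>.\<close>
    have "measure lebesgue ({a..<2 * pi} \<union> {0..a + g - 2 * pi})
        = measure lebesgue {a..<2 * pi} + measure lebesgue {0..a + g - 2 * pi}"
      using a g False by (intro measure_Union) auto
    moreover have "{a..<2 * pi} \<union> {0..a + g - 2 * pi} \<in> lmeasurable"
      using a g False by (intro fmeasurable.Un) (auto simp: fmeasurable_def)
    ultimately show ?thesis unfolding D cone_angle_def using a g False by simp
  qed
qed

lemma cone_angle_UNIV: "directions_in UNIV \<in> lmeasurable \<and> cone_angle UNIV = 2 * pi"
proof -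
  have "directions_in UNIV = {0..<2 * pi}" by (auto simp: directions_in_def)
  then show ?thesis by (auto simp: cone_angle_def fmeasurable_def)
qed

lemma sin_nonneg_iff:
  assumes "0 \<le> s" "s < 2 * pi"
  shows "sin s \<ge> 0 \<longleftrightarrow> s \<le> pi"
  using sin_ge_zero[of s] sin_lt_zero[of s] assms by force

lemma cone_angle_half_plane:
  assumes "d \<noteq> 0"
  shows "directions_in (half_plane d) \<in> lmeasurable \<and> cone_angle (half_plane d) = pi"
proof -
  obtain a where a: "0 \<le> a" "a < 2 * pi" and d: "d = norm d *\<^sub>R direction a"
    using polar_form[OF assms] by blast
  have n: "norm d > 0" using assms by simp
  show ?thesis
  proof (rule cone_angle_arc[OF a])
    fix s assume s: "0 \<le> s" "s < 2 * pi"
    have "cross2 d (direction (a + s)) = norm d * sin s"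
      by (subst d) (simp add: cross2_simps cross2_direction)
    then show "direction (a + s) \<in> half_plane d \<longleftrightarrow> s \<le> pi"
      using sin_nonneg_iff[OF s] n by (simp add: half_plane_def zero_le_mult_iff)
  qed (auto simp: pi_gt_zero)
qed

section \<open>Wedges and their angles\<close>

lemma wedge_commute: "wedge a b = wedge b a"
proof -
  have "wedge a b \<subseteq> wedge b a" for a b
    unfolding wedge_def by clarify (metis add.commute)
  then show ?thesis by blast
qed

text \<open>By Cramer's rule the coordinates of \<open>d\<close> along \<open>a\<close> and
  \<open>b\<close> are quotients of cross products; the factor \<open>s\<close> makes their common
  denominator positive.\<close>

lemma wedge_iff:
  assumes "s * cross2 a b > 0"
  shows "d \<in> wedge a b \<longleftrightarrow> s * cross2 a d \<ge> 0 \<and> s * cross2 d b \<ge> 0"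
proof
  assume "d \<in> wedge a b"
  then obtain x y where d: "d = x *\<^sub>R a + y *\<^sub>R b" and xy: "0 \<le> x" "0 \<le> y"
    by (auto simp: wedge_def)
  have "s * cross2 a d = y * (s * cross2 a b)" "s * cross2 d b = x * (s * cross2 a b)"
    by (simp_all add: d cross2_simps)
  then show "s * cross2 a d \<ge> 0 \<and> s * cross2 d b \<ge> 0"
    using xy assms by (metis less_imp_le mult_nonneg_nonneg)
next
  assume d: "s * cross2 a d \<ge> 0 \<and> s * cross2 d b \<ge> 0"
  have nz: "cross2 a b \<noteq> 0" "s \<noteq> 0" using assms by auto
  have "d = (1 / cross2 a b) *\<^sub>R (cross2 a b *\<^sub>R d)" using nz by simp
  also have "\<dots> = (cross2 d b / cross2 a b) *\<^sub>R a + (cross2 a d / cross2 a b) *\<^sub>R b"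
    by (subst cross2_decompose) (simp add: scaleR_add_right)
  also have "\<dots> = ((s * cross2 d b) / (s * cross2 a b)) *\<^sub>R a
      + ((s * cross2 a d) / (s * cross2 a b)) *\<^sub>R b"
    using nz by simp
  finally show "d \<in> wedge a b"
    using d assms unfolding wedge_def by (blast intro: divide_nonneg_pos)
qed

text \<open>Inner and cross product with \<open>a\<close> are, up to \<open>norm a\<close>, the
  coordinates of \<open>b\<close> in the frame rotated by \<open>t\<close>. Rotating back gives the
  polar form of \<open>b\<close>.\<close>

lemma direction_angle_between:
  assumes a: "a = norm a *\<^sub>R direction t" and "cross2 a b > 0"
  shows "b = norm b *\<^sub>R direction (t + angle_between a b)"
proof -
  have nz: "a \<noteq> 0" "b \<noteq> 0" using cross2_nonzeroD assms by (metis less_irrefl)+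
  have c: "norm a * norm b * cos (angle_between a b) = a \<bullet> b"
    using nz by (simp add: cos_angle_between)
  have s: "norm a * norm b * sin (angle_between a b) = cross2 a b"
    using nz assms(2) by (simp add: sin_angle_between)
  have a12: "a$1 = norm a * cos t" "a$2 = norm a * sin t"
    by (subst a; simp)+
  have "norm a * (norm b * cos (angle_between a b)) = norm a * (cos t * b$1 + sin t * b$2)"
    using c unfolding inner2 a12 by (simp add: distrib_left)
  then have "norm b * cos (angle_between a b) = cos t * b$1 + sin t * b$2" using nz by simp
  moreover have "norm a * (norm b * sin (angle_between a b)) = norm a * (cos t * b$2 - sin t * b$1)"
    using s unfolding cross2_def a12 by (simp add: right_diff_distrib)
  then have "norm b * sin (angle_between a b) = cos t * b$2 - sin t * b$1" using nz by simp
  moreover have "(cos t)\<^sup>2 + (sin t)\<^sup>2 = 1" by simp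
  ultimately have "norm b * cos (t + angle_between a b) = b$1"
    "norm b * sin (t + angle_between a b) = b$2"
    unfolding cos_add sin_add by algebra+
  then show ?thesis by (simp add: vec_eq_iff forall_2)
qed

lemma cone_angle_wedge_pos:
  assumes "cross2 a b > 0"
  shows "directions_in (wedge a b) \<in> lmeasurable \<and> cone_angle (wedge a b) = angle_between a b"
proof -
  let ?g = "angle_between a b"
  have nz: "a \<noteq> 0" "b \<noteq> 0" using cross2_nonzeroD assms by (metis less_irrefl)+
  obtain t where t: "0 \<le> t" "t < 2 * pi" and a: "a = norm a *\<^sub>R direction t"
    using polar_form[OF nz(1)] by blast
  have b: "b = norm b *\<^sub>R direction (t + ?g)"
    using direction_angle_between[OF a assms] .
  have g: "0 < ?g" "?g < pi" using angle_between_strict_bounds assms by auto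
  show ?thesis
  proof (rule cone_angle_arc[OF t])
    fix s assume s: "0 \<le> s" "s < 2 * pi"
    have "cross2 a (direction (t + s)) = norm a * sin s"
      by (subst a) (simp add: cross2_simps cross2_direction)
    moreover have "cross2 (direction (t + s)) b = norm b * sin (?g - s)"
      by (subst b) (simp add: cross2_simps cross2_direction)
    ultimately have "direction (t + s) \<in> wedge a b \<longleftrightarrow> sin s \<ge> 0 \<and> sin (?g - s) \<ge> 0"
      using wedge_iff[of 1 a b] assms nz by (simp add: zero_le_mult_iff)
    \<comment> \<open>If \<open>s > ?g\<close>, then \<open>sin s \<ge> 0\<close> forces
      \<open>s \<le> pi\<close>, so \<open>s - ?g\<close> lies strictly between 0 and
      \<open>pi\<close> and has positive sine.\<close>
    also have "\<dots> \<longleftrightarrow> s \<le> ?g"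
    proof
      assume "sin s \<ge> 0 \<and> sin (?g - s) \<ge> 0"
      then have "s \<le> pi" "sin (s - ?g) \<le> 0"
        using sin_nonneg_iff[OF s] sin_minus[of "?g - s"] by auto
      then show "s \<le> ?g" using sin_gt_zero[of "s - ?g"] g s by force
    next
      assume "s \<le> ?g"
      then show "sin s \<ge> 0 \<and> sin (?g - s) \<ge> 0"
        using g s by (auto intro!: sin_ge_zero)
    qed
    finally show "direction (t + s) \<in> wedge a b \<longleftrightarrow> s \<le> ?g" .
  qed (use g in auto)
qed

lemma cone_angle_wedge:
  assumes "cross2 a b \<noteq> 0"
  shows "directions_in (wedge a b) \<in> lmeasurable \<and> cone_angle (wedge a b) = angle_between a b"
proof (cases "cross2 a b > 0")
  case True
  then show ?thesis by (rule cone_angle_wedge_pos)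
next
  case False
  then have "cross2 b a > 0" using assms cross2_swap[of b a] by auto
  then show ?thesis
    using cone_angle_wedge_pos wedge_commute angle_between_commute by metis
qed

text \<open>Pairwise parallel vectors have at most two opposite directions. This makes the overlap
  of two tangent cones a null set.\<close>

lemma finite_directions_in_line:
  assumes "\<And>a b. a \<in> K \<Longrightarrow> b \<in> K \<Longrightarrow> cross2 a b = 0"
  shows "finite (directions_in K)"
proof (cases "directions_in K = {}")
  case False
  then obtain u where u: "u \<in> directions_in K" by blast
  have "directions_in K \<subseteq> {u - pi, u, u + pi}"
  proof
    fix t assume t: "t \<in> directions_in K"
    have "sin (t - u) = 0"
      using assms t u cross2_direction[of u t] by (auto simp: directions_in_def)
    moreover have "\<bar>t - u\<bar> < 2 * pi" using t u by (auto simp: directions_in_def)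
    ultimately have "t - u = 0 \<or> t - u = pi \<or> t - u = - pi"
    proof -
      obtain n :: int where n: "t - u = of_int n * pi"
        using \<open>sin (t - u) = 0\<close> sin_zero_iff_int2 by blast
      then have "\<bar>of_int n\<bar> * pi < 2 * pi" using \<open>\<bar>t - u\<bar> < 2 * pi\<close> by (simp add: abs_mult)
      then have "\<bar>of_int n\<bar> < (2::real)" by simp
      then have "n = 0 \<or> n = 1 \<or> n = -1" by linarith
      then show ?thesis using n by auto
    qed
    then show "t \<in> {u - pi, u, u + pi}" by auto
  qed
  then show ?thesis by (rule finite_subset) auto
qed auto

section \<open>Tangent cones of convex sets and pentagons\<close>

text \<open>The cone of feasible directions, with no closure taken. At the points of a pentagon it
  is a wedge, a half plane or the whole plane, hence closed anyway.\<close>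

definition tangent_cone :: "(real^2) set \<Rightarrow> real^2 \<Rightarrow> (real^2) set" where
  "tangent_cone X x = {d. \<exists>e>0. x + e *\<^sub>R d \<in> X}"

lemma diff_mem_tangent_cone: "y \<in> X \<Longrightarrow> y - x \<in> tangent_cone X x"
  unfolding tangent_cone_def by (auto intro!: exI[of _ 1])

lemma tangent_cone_near:
  assumes "convex X" "x \<in> X" "d \<in> tangent_cone X x"
  obtains r where "r > 0" "\<And>e. 0 \<le> e \<Longrightarrow> e \<le> r \<Longrightarrow> x + e *\<^sub>R d \<in> X"
proof -
  obtain r where r: "r > 0" "x + r *\<^sub>R d \<in> X"
    using assms(3) by (auto simp: tangent_cone_def)
  have "x + e *\<^sub>R d \<in> X" if "0 \<le> e" "e \<le> r" for e
  proof -
    have "(1 - e / r) *\<^sub>R x + (e / r) *\<^sub>R (x + r *\<^sub>R d) \<in> X"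
      using that r assms by (intro convexD) auto
    also have "(1 - e / r) *\<^sub>R x + (e / r) *\<^sub>R (x + r *\<^sub>R d) = x + e *\<^sub>R d"
      using r by (simp add: algebra_simps)
    finally show ?thesis .
  qed
  then show ?thesis using that r(1) by blast
qed

text \<open>Near \<open>x\<close> the set contains a small triangle spanned by \<open>a\<close> and
  \<open>b\<close>: each of its points is the midpoint of two points on the rays, at twice the
  parameters, hence the halved bound.\<close>

lemma tangent_cone_combine:
  assumes "convex X" "x \<in> X" "a \<in> tangent_cone X x" "b \<in> tangent_cone X x"
  obtains r where "r > 0" "\<And>s t. 0 \<le> s \<Longrightarrow> 0 \<le> t \<Longrightarrow> s + t \<le> r \<Longrightarrow> x + s *\<^sub>R a + t *\<^sub>R b \<in> X"
proof -
  obtain u where u: "u > 0" "\<And>e. 0 \<le> e \<Longrightarrow> e \<le> u \<Longrightarrow> x + e *\<^sub>R a \<in> X"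
    using tangent_cone_near assms by metis
  obtain v where v: "v > 0" "\<And>e. 0 \<le> e \<Longrightarrow> e \<le> v \<Longrightarrow> x + e *\<^sub>R b \<in> X"
    using tangent_cone_near assms by metis
  have "x + s *\<^sub>R a + t *\<^sub>R b \<in> X" if "0 \<le> s" "0 \<le> t" "s + t \<le> min u v / 2" for s t
  proof -
    have "(1/2) *\<^sub>R (x + (2 * s) *\<^sub>R a) + (1/2) *\<^sub>R (x + (2 * t) *\<^sub>R b) \<in> X"
      using that assms(1) u v by (intro convexD) auto
    also have "(1/2) *\<^sub>R (x + (2 * s) *\<^sub>R a) + (1/2) *\<^sub>R (x + (2 * t) *\<^sub>R b)
        = ((1/2) *\<^sub>R x + (1/2) *\<^sub>R x) + s *\<^sub>R a + t *\<^sub>R b"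
      by (simp add: algebra_simps)
    finally show ?thesis by (simp flip: scaleR_add_left)
  qed
  then show ?thesis using that[of "min u v / 2"] u v by auto
qed

lemma wedge_subset_tangent_cone:
  assumes "convex X" "x \<in> X" "a \<in> tangent_cone X x" "b \<in> tangent_cone X x"
  shows "wedge a b \<subseteq> tangent_cone X x"
proof
  fix d assume "d \<in> wedge a b"
  then obtain s t where d: "d = s *\<^sub>R a + t *\<^sub>R b" and st: "0 \<le> s" "0 \<le> t"
    by (auto simp: wedge_def)
  obtain r where r: "r > 0"
    "\<And>s t. 0 \<le> s \<Longrightarrow> 0 \<le> t \<Longrightarrow> s + t \<le> r \<Longrightarrow> x + s *\<^sub>R a + t *\<^sub>R b \<in> X"
    using tangent_cone_combine[OF assms] by metis
  \<comment> \<open>The summand 1 keeps the denominator positive when \<open>s\<close> and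
    \<open>t\<close> both vanish.\<close>
  define e where "e = r / (s + t + 1)"
  have "e > 0" using r st by (simp add: e_def)
  have "e * s + e * t = r * ((s + t) / (s + t + 1))" by (simp add: e_def add_divide_distrib distrib_left)
  also have "\<dots> \<le> r * 1" using r st by (intro mult_left_mono) auto
  finally have "x + (e * s) *\<^sub>R a + (e * t) *\<^sub>R b \<in> X"
    using r(2)[of "e * s" "e * t"] st \<open>e > 0\<close> by simp
  then show "d \<in> tangent_cone X x"
    unfolding tangent_cone_def d using \<open>e > 0\<close> by (auto simp: algebra_simps)
qed

lemma continuous_on_cross2 [continuous_intros]:
  "continuous_on S f \<Longrightarrow> continuous_on S g \<Longrightarrow> continuous_on S (\<lambda>y. cross2 (f y) (g y))"
  unfolding cross2_def by (intro continuous_intros)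

text \<open>Both sets contain a common small triangle with apex \<open>x\<close>. For distinct tiles
  this contradicts disjoint interiors; with \<open>X = Y\<close> it shows that a pentagon has
  interior points.\<close>

lemma interiors_meet:
  assumes X: "convex X" "x \<in> X" "a \<in> tangent_cone X x" "b \<in> tangent_cone X x"
    and Y: "convex Y" "x \<in> Y" "a \<in> tangent_cone Y x" "b \<in> tangent_cone Y x"
    and ab: "cross2 a b \<noteq> 0"
  shows "interior X \<inter> interior Y \<noteq> {}"
proof -
  obtain u where u: "u > 0"
    "\<And>s t. 0 \<le> s \<Longrightarrow> 0 \<le> t \<Longrightarrow> s + t \<le> u \<Longrightarrow> x + s *\<^sub>R a + t *\<^sub>R b \<in> X"
    using tangent_cone_combine[OF X] by metis
  obtain v where v: "v > 0"
    "\<And>s t. 0 \<le> s \<Longrightarrow> 0 \<le> t \<Longrightarrow> s + t \<le> v \<Longrightarrow> x + s *\<^sub>R a + t *\<^sub>R b \<in> Y"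
    using tangent_cone_combine[OF Y] by metis
  define r where "r = min u v"
  have r: "r > 0" "r \<le> u" "r \<le> v" using u v by (auto simp: r_def)
  let ?s = "\<lambda>y. cross2 (y - x) b / cross2 a b"
  let ?t = "\<lambda>y. cross2 a (y - x) / cross2 a b"
  \<comment> \<open>The open triangle at \<open>x\<close>, written in coordinates along
    \<open>a\<close> and \<open>b\<close>.\<close>
  define U where "U = {y. 0 < ?s y} \<inter> {y. 0 < ?t y} \<inter> {y. ?s y + ?t y < r}"
  have "open U" unfolding U_def using ab
    by (intro open_Int open_Collect_less continuous_intros) auto
  have dec: "y = x + ?s y *\<^sub>R a + ?t y *\<^sub>R b" for y
  proof -
    have "y - x = (1 / cross2 a b) *\<^sub>R (cross2 a b *\<^sub>R (y - x))" using ab by simp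
    also have "\<dots> = ?s y *\<^sub>R a + ?t y *\<^sub>R b"
      by (subst cross2_decompose) (simp add: scaleR_add_right)
    finally show ?thesis by (simp add: algebra_simps)
  qed
  have "U \<subseteq> X" "U \<subseteq> Y"
  proof -
    show "U \<subseteq> X"
    proof
      fix y assume "y \<in> U"
      then show "y \<in> X" using dec[of y] u(2)[of "?s y" "?t y"] r by (auto simp: U_def)
    qed
    show "U \<subseteq> Y"
    proof
      fix y assume "y \<in> U"
      then show "y \<in> Y" using dec[of y] v(2)[of "?s y" "?t y"] r by (auto simp: U_def)
    qed
  qed
  moreover have "x + (r/3) *\<^sub>R a + (r/3) *\<^sub>R b \<in> U"
    using r ab by (auto simp: U_def cross2_simps)
  ultimately show ?thesis using \<open>open U\<close> interior_maximal by blast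
qed

text \<open>The point lies inside a segment of \<open>X\<close>, so the cone contains a whole line.
  An interior point of \<open>X\<close> supplies a vector off this line, and the line together with
  such a vector generates a half plane.\<close>

lemma tangent_cone_not_extreme:
  assumes X: "convex X" "interior X \<noteq> {}" "x \<in> X" and ne: "\<not> x extreme_point_of X"
  shows "tangent_cone X x = UNIV \<or> (\<exists>d. d \<noteq> 0 \<and> tangent_cone X x = half_plane d)"
proof -
  let ?K = "tangent_cone X x"
  obtain y z where yz: "y \<in> X" "z \<in> X" "x \<in> open_segment y z"
    using ne X(3) by (auto simp: extreme_point_of_def)
  then obtain t where t: "0 < t" "t < 1" "x = (1 - t) *\<^sub>R y + t *\<^sub>R z" and "y \<noteq> z"
    by (auto simp: in_segment)
  define d where "d = z - y"
  have "d \<noteq> 0" using \<open>y \<noteq> z\<close> by (simp add: d_def)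
  have "x + (1 - t) *\<^sub>R d = z" "x + t *\<^sub>R (- d) = y"
    using t by (simp_all add: d_def algebra_simps)
  then have dK: "d \<in> ?K" "- d \<in> ?K"
    unfolding tangent_cone_def using yz t by (metis (mono_tags, lifting) diff_gt_0_iff_gt mem_Collect_eq)+
  \<comment> \<open>The wedges spanned by \<open>k\<close> with \<open>d\<close> and with
    \<open>- d\<close> together fill the half plane on the side of \<open>k\<close>.\<close>
  have half: "half_plane (s *\<^sub>R d) \<subseteq> ?K" if k: "k \<in> ?K" "s * cross2 d k > 0" for k s
  proof
    fix w assume w: "w \<in> half_plane (s *\<^sub>R d)"
    have c: "cross2 d k \<noteq> 0" using k by auto
    have sw: "s * cross2 d w \<ge> 0" using w by (simp add: half_plane_def cross2_simps)
    show "w \<in> ?K"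
    proof (cases "s * cross2 w k \<ge> 0")
      case True
      then have "w \<in> wedge d k" using wedge_iff[of s d k w] k sw by auto
      then show ?thesis using wedge_subset_tangent_cone X(1,3) dK(1) k(1) by blast
    next
      case False
      then have "w \<in> wedge (- d) k"
        using wedge_iff[of "- s" "- d" k w] k sw by (auto simp: cross2_simps)
      then show ?thesis using wedge_subset_tangent_cone X(1,3) dK(2) k(1) by blast
    qed
  qed
  obtain k where k: "k \<in> ?K" "cross2 d k \<noteq> 0"
  proof -
    obtain c r where r: "r > 0" "ball c r \<subseteq> X"
      using X(2) by (meson ex_in_conv mem_interior)
    \<comment> \<open>\<open>q\<close> is \<open>d\<close> after a quarter turn. Moving from
      \<open>c\<close> along \<open>q\<close> inside the ball changes the cross product with
      \<open>d\<close>, so \<open>c - x\<close> and \<open>c' - x\<close> cannot both be parallel to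
      \<open>d\<close>.\<close>
    define q :: "real^2" where "q = vector [- d$2, d$1]"
    have q: "cross2 d q = d \<bullet> d" by (simp add: cross2_def q_def inner2 vector_2)
    have "q \<noteq> 0" using q \<open>d \<noteq> 0\<close> by (auto simp: cross2_simps)
    define c' where "c' = c + (r / (2 * norm q)) *\<^sub>R q"
    have "c \<in> X" "c' \<in> X"
      using r \<open>q \<noteq> 0\<close> by (auto simp: c'_def dist_norm subset_iff)
    have "cross2 d (c' - x) = cross2 d (c - x) + (r / (2 * norm q)) * (d \<bullet> d)"
      by (simp add: c'_def cross2_simps q algebra_simps)
    then have "cross2 d (c' - x) \<noteq> cross2 d (c - x)"
      using r \<open>q \<noteq> 0\<close> \<open>d \<noteq> 0\<close> by simp
    then show ?thesis using that diff_mem_tangent_cone \<open>c \<in> X\<close> \<open>c' \<in> X\<close> by metis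
  qed
  \<comment> \<open>The sign orients the line so that \<open>k\<close> lies to the left of
    \<open>s *\<^sub>R d\<close>.\<close>
  define s where "s = sgn (cross2 d k)"
  have s: "s * cross2 d k > 0" "s \<noteq> 0"
    using k by (auto simp: s_def sgn_if)
  show ?thesis
  proof (cases "?K \<subseteq> half_plane (s *\<^sub>R d)")
    case True
    then have "?K = half_plane (s *\<^sub>R d)" using half[OF k(1) s(1)] by blast
    then show ?thesis using s \<open>d \<noteq> 0\<close> by (metis scaleR_eq_0_iff)
  next
    case False
    then obtain l where l: "l \<in> ?K" "s * cross2 d l < 0"
      by (auto simp: half_plane_def cross2_simps subset_iff not_le)
    have "half_plane (s *\<^sub>R d) \<subseteq> ?K" "half_plane (- s *\<^sub>R d) \<subseteq> ?K"
      using half[OF k(1) s(1)] half[OF l(1), of "- s"] l by auto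
    moreover have "w \<in> half_plane (s *\<^sub>R d) \<or> w \<in> half_plane (- s *\<^sub>R d)" for w
      by (auto simp: half_plane_def cross2_simps)
    ultimately show ?thesis by blast
  qed
qed

lemma cone_angle_not_extreme:
  assumes "convex X" "interior X \<noteq> {}" "x \<in> X" "\<not> x extreme_point_of X"
  shows "directions_in (tangent_cone X x) \<in> lmeasurable"
    "cone_angle (tangent_cone X x) = pi \<or> cone_angle (tangent_cone X x) = 2 * pi"
  using tangent_cone_not_extreme[OF assms] cone_angle_UNIV cone_angle_half_plane by auto

section \<open>Supporting lines and tangent cones at the corners of a pentagon\<close>

lemma pentagon_region_supporting:
  assumes p: "oriented_pentagon s p" and i: "i < 5" and x: "x \<in> pentagon_region p"
  shows "s * cross2 (p ((i+1) mod 5) - p i) (x - p i) \<ge> 0"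
proof -
  define e where "e = p ((i+1) mod 5) - p i"
  let ?l = "\<lambda>x. s * cross2 e x"
  \<comment> \<open>A half plane bounded by the line of edge \<open>i\<close>; containing all five
    corners, it contains their convex hull.\<close>
  let ?H = "{x. ?l (p i) \<le> ?l x}"
  have "convex ?H"
  proof (rule convexI)
    fix x y u v assume xy: "x \<in> ?H" "y \<in> ?H" and uv: "0 \<le> u" "0 \<le> v" "u + v = (1::real)"
    have "?l (p i) = u * ?l (p i) + v * ?l (p i)" using uv by (simp flip: distrib_right)
    also have "\<dots> \<le> u * ?l x + v * ?l y"
      using xy uv by (intro add_mono[OF mult_left_mono mult_left_mono]) auto
    also have "\<dots> = ?l (u *\<^sub>R x + v *\<^sub>R y)" by (simp add: cross2_simps algebra_simps)
    finally show "u *\<^sub>R x + v *\<^sub>R y \<in> ?H" by simp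
  qed
  moreover have "p ` {..<5} \<subseteq> ?H"
  proof clarify
    fix j :: nat assume j: "j < 5"
    have "s * cross2 e (p j - p i) \<ge> 0"
    proof (cases "j = i \<or> j = (i+1) mod 5")
      case True
      then have "p j - p i = 0 \<or> p j - p i = e" by (auto simp: e_def)
      then show ?thesis by (auto simp: cross2_simps(9,11))
    next
      case False
      then show ?thesis using p i j
        by (auto simp: oriented_pentagon_def e_def intro: less_imp_le)
    qed
    then show "?l (p i) \<le> ?l (p j)"
      by (simp only: cross2_simps(4) right_diff_distrib diff_ge_0_iff_ge)
  qed
  ultimately have "convex hull (p ` {..<5}) \<subseteq> ?H" by (rule hull_minimal[rotated])
  then have "x \<in> ?H" using x by (auto simp: pentagon_region_def)
  then show ?thesis
    unfolding e_def[symmetric]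
    by (simp only: cross2_simps(4) right_diff_distrib diff_ge_0_iff_ge mem_Collect_eq)
qed

lemma corner_in_region: "i < 5 \<Longrightarrow> p i \<in> pentagon_region p"
  unfolding pentagon_region_def by (rule hull_inc) auto

text \<open>The supporting lines of the two edges at a corner confine the tangent cone to the wedge
  of these edges, and the edges themselves generate the wedge. It contains no line, so the corner is
  extreme.\<close>

lemma pentagon_corner:
  assumes p: "oriented_pentagon s p" and i: "i < 5"
  defines "a \<equiv> p ((i+4) mod 5) - p i" and "b \<equiv> p ((i+1) mod 5) - p i"
  shows "s * cross2 b a > 0" "tangent_cone (pentagon_region p) (p i) = wedge b a"
    "p i extreme_point_of pentagon_region p" "interior (pentagon_region p) \<noteq> {}"
proof -
  let ?P = "pentagon_region p"
  have "i = 0 \<or> i = 1 \<or> i = 2 \<or> i = 3 \<or> i = 4" using i by auto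
  then have m: "(i+4) mod 5 \<noteq> i" "(i+4) mod 5 \<noteq> (i+1) mod 5" "((i+4) mod 5 + 1) mod 5 = i"
    by auto
  show ba: "s * cross2 b a > 0"
    using p i m by (auto simp: oriented_pentagon_def a_def b_def)
  have cP: "convex ?P" by (simp add: pentagon_region_def)
  have abK: "a \<in> tangent_cone ?P (p i)" "b \<in> tangent_cone ?P (p i)"
    unfolding a_def b_def by (auto intro!: diff_mem_tangent_cone corner_in_region)
  show W: "tangent_cone ?P (p i) = wedge b a"
  proof
    show "wedge b a \<subseteq> tangent_cone ?P (p i)"
      using abK cP i by (intro wedge_subset_tangent_cone corner_in_region) auto
    show "tangent_cone ?P (p i) \<subseteq> wedge b a"
    proof
      fix d assume "d \<in> tangent_cone ?P (p i)"
      then obtain e where e: "e > 0" "p i + e *\<^sub>R d \<in> ?P" by (auto simp: tangent_cone_def)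
      have "s * cross2 b (e *\<^sub>R d) \<ge> 0"
        using pentagon_region_supporting[OF p i e(2)] by (simp add: b_def)
      then have "e * (s * cross2 b d) \<ge> 0" by (simp add: cross2_simps algebra_simps)
      then have 1: "s * cross2 b d \<ge> 0" using e(1) by (simp add: zero_le_mult_iff)
      \<comment> \<open>Index \<open>(i+4) mod 5\<close> precedes \<open>i\<close>, so this is the
        supporting line of the edge that ends at \<open>p i\<close>.\<close>
      have "s * cross2 (p (((i+4) mod 5 + 1) mod 5) - p ((i+4) mod 5))
          (p i + e *\<^sub>R d - p ((i+4) mod 5)) \<ge> 0"
        using pentagon_region_supporting[OF p _ e(2), of "(i+4) mod 5"] by simp
      then have "s * cross2 (- a) (e *\<^sub>R d - a) \<ge> 0"
        unfolding m(3) a_def by (simp add: algebra_simps)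
      then have "e * (s * cross2 d a) \<ge> 0"
        by (simp add: cross2_simps cross2_swap[of d a] algebra_simps)
      then have "s * cross2 d a \<ge> 0" using e(1) by (simp add: zero_le_mult_iff)
      then show "d \<in> wedge b a" using 1 wedge_iff[OF ba] by blast
    qed
  qed
  show "p i extreme_point_of ?P"
  proof (rule ccontr)
    assume "\<not> p i extreme_point_of ?P"
    then obtain y z where yz: "y \<in> ?P" "z \<in> ?P" "p i \<in> open_segment y z"
      using corner_in_region[OF i] by (auto simp: extreme_point_of_def)
    then obtain t where t: "0 < t" "t < 1" "p i = (1 - t) *\<^sub>R y + t *\<^sub>R z" and "y \<noteq> z"
      by (auto simp: in_segment)
    have "p i + (1 - t) *\<^sub>R (z - y) = z" "p i + t *\<^sub>R (y - z) = y"
      using t by (simp_all add: algebra_simps)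
    then have "z - y \<in> wedge b a" "y - z \<in> wedge b a"
      unfolding W[symmetric] tangent_cone_def using yz t
      by (metis (mono_tags, lifting) diff_gt_0_iff_gt mem_Collect_eq)+
    then have "s * cross2 b (z - y) = 0" "s * cross2 (z - y) a = 0"
      unfolding wedge_iff[OF ba] by (auto simp: cross2_simps algebra_simps)
    moreover have "s \<noteq> 0" "cross2 b a \<noteq> 0" using ba by auto
    ultimately have "cross2 b a *\<^sub>R (z - y) = 0" by (subst cross2_decompose) simp
    then show False using \<open>cross2 b a \<noteq> 0\<close> \<open>y \<noteq> z\<close> by simp
  qed
  have "cross2 b a \<noteq> 0" using ba by auto
  then show "interior ?P \<noteq> {}"
    using interiors_meet[OF cP corner_in_region[OF i] abK(2,1) cP corner_in_region[OF i] abK(2,1)] by blast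
qed

lemma cone_angle_corner:
  assumes "oriented_pentagon s p" "i < 5"
  shows "directions_in (tangent_cone (pentagon_region p) (p i)) \<in> lmeasurable"
    "cone_angle (tangent_cone (pentagon_region p) (p i)) = corner_angle p i"
    "0 < corner_angle p i" "corner_angle p i < pi"
proof -
  let ?a = "p ((i+4) mod 5) - p i" and ?b = "p ((i+1) mod 5) - p i"
  have c: "cross2 ?b ?a \<noteq> 0" using pentagon_corner(1)[OF assms] by auto
  show "directions_in (tangent_cone (pentagon_region p) (p i)) \<in> lmeasurable"
    "cone_angle (tangent_cone (pentagon_region p) (p i)) = corner_angle p i"
    using cone_angle_wedge[OF c] unfolding pentagon_corner(2)[OF assms] corner_angle_def
    by (auto simp: angle_between_commute)
  show "0 < corner_angle p i" "corner_angle p i < pi"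
    using angle_between_strict_bounds[OF c] by (auto simp: corner_angle_def angle_between_commute)
qed

lemma extreme_points_pentagon_region:
  assumes "oriented_pentagon s p"
  shows "{x. x extreme_point_of pentagon_region p} = p ` {..<5}"
  using extreme_points_of_convex_hull[of "p ` {..<5}"] pentagon_corner(3)[OF assms]
  unfolding pentagon_region_def by auto

lemma inj_on_pentagon:
  assumes "oriented_pentagon s p"
  shows "inj_on p {..<5}"
proof (rule inj_onI, rule ccontr)
  fix i j assume ij: "i \<in> {..<5}" "j \<in> {..<5}" "p i = p j" "i \<noteq> j"
  show False
  proof (cases "j = (i+1) mod 5")
    case True
    then show False using pentagon_corner(1)[OF assms, of i] ij by (auto simp: cross2_simps)
  next
    case False
    then have "s * cross2 (p ((i+1) mod 5) - p i) (p j - p i) > 0"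
      using assms ij unfolding oriented_pentagon_def by (metis lessThan_iff)
    then show False using ij by (simp add: cross2_simps)
  qed
qed

section \<open>Tilings by congruent pentagons\<close>

lemma isometry2_affine:
  assumes "isometry2 f"
  obtains L where "orthogonal_transformation L" "f = (\<lambda>x. f 0 + L x)"
proof
  show "orthogonal_transformation (\<lambda>x. f x - f 0)"
    using assms unfolding orthogonal_transformation_isometry isometry2_def
    by (simp add: dist_norm)
qed auto

text \<open>The factor is the determinant of \<open>L\<close>.\<close>

lemma cross2_linear:
  assumes "linear L"
  shows "cross2 (L a) (L b) = cross2 (L (axis 1 1)) (L (axis 2 1)) * cross2 a b"
proof -
  have e: "x = x$1 *\<^sub>R axis 1 1 + x$2 *\<^sub>R axis 2 1" for x :: "real^2"
    by (simp add: vec_eq_iff forall_2 axis_def)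
  have L: "L x = x$1 *\<^sub>R L (axis 1 1) + x$2 *\<^sub>R L (axis 2 1)" for x
    by (subst e[of x]) (simp only: linear_add[OF assms] linear_scale[OF assms])
  show ?thesis
    by (subst L[of a], subst L[of b]) (simp add: cross2_def algebra_simps)
qed

text \<open>Norms and inner products are preserved, so Lagrange's identity gives the determinant
  square 1. Its sign is left open because of reflections.\<close>

lemma cross2_orthogonal_transformation:
  assumes "orthogonal_transformation L"
  obtains k where "k \<noteq> 0" "\<And>a b. cross2 (L a) (L b) = k * cross2 a b"
proof -
  let ?k = "cross2 (L (axis 1 1)) (L (axis 2 1))"
  have "(cross2 (L a) (L b))\<^sup>2 = (cross2 a b)\<^sup>2" for a b
    using cross2_square_add_inner_square[of "L a" "L b"] cross2_square_add_inner_square[of a b] assms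
    by (simp add: orthogonal_transformation_norm orthogonal_transformation_def)
  moreover have "cross2 (axis 1 1) (axis 2 1) = 1" by (simp add: cross2_def axis_def)
  ultimately have "?k \<noteq> 0" by (metis power2_eq_square mult_zero_left zero_neq_one one_power2)
  then show ?thesis
    using that cross2_linear[OF orthogonal_transformation_linear[OF assms]] by blast
qed

text \<open>The images of the corners, in the same cyclic order, are the corners of the copy. A
  reflection reverses their orientation, which the factor \<open>s * k\<close> records.\<close>

lemma congruent_pentagon:
  assumes p: "oriented_pentagon s p" and X: "congruent2 (pentagon_region p) X"
  obtains s' q where "oriented_pentagon s' q" "X = pentagon_region q"
    "\<And>i. corner_angle q i = corner_angle p i"
proof -
  obtain f where f: "isometry2 f" "f ` pentagon_region p = X"
    using X by (auto simp: congruent2_def)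
  obtain L where L: "orthogonal_transformation L" "f = (\<lambda>x. f 0 + L x)"
    using isometry2_affine[OF f(1)] .
  have lin: "linear L" using L(1) by (rule orthogonal_transformation_linear)
  obtain k where k: "k \<noteq> 0" "\<And>a b. cross2 (L a) (L b) = k * cross2 a b"
    using cross2_orthogonal_transformation[OF L(1)] by blast
  define q where "q = f \<circ> p"
  have d: "q i - q j = L (p i - p j)" for i j
    unfolding q_def o_def by (subst (1 2) L(2)) (simp add: linear_diff[OF lin])
  show ?thesis
  proof (rule that)
    show "oriented_pentagon (s * k) q"
      unfolding oriented_pentagon_def
    proof (intro allI impI)
      fix i j :: nat assume *: "i < 5" "j < 5" "j \<noteq> i \<and> j \<noteq> (i + 1) mod 5"
      have "s * k * cross2 (q ((i + 1) mod 5) - q i) (q j - q i)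
          = k\<^sup>2 * (s * cross2 (p ((i + 1) mod 5) - p i) (p j - p i))"
        unfolding d k(2) by (simp add: power2_eq_square)
      also have "\<dots> > 0"
        using p * k(1) unfolding oriented_pentagon_def by (metis mult_pos_pos zero_less_power2)
      finally show "s * k * cross2 (q ((i + 1) mod 5) - q i) (q j - q i) > 0" .
    qed
    have "f ` S = (\<lambda>x. f 0 + x) ` L ` S" for S
      by (subst L(2)) auto
    then show "X = pentagon_region q"
      unfolding f(2)[symmetric] pentagon_region_def q_def image_comp[symmetric]
      by (simp add: convex_hull_translation convex_hull_linear_image[OF lin])
    show "corner_angle q i = corner_angle p i" for i
      unfolding corner_angle_def d angle_between_def using L(1)
      by (simp add: orthogonal_transformation_norm orthogonal_transformation_def)
  qed
qed

text \<open>One inner radius and one outer radius serve all copies; local finiteness of the tiling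
  rests on this.\<close>

lemma congruent_uniform_balls:
  assumes "bounded P" "interior P \<noteq> {}"
  obtains r D where "r > 0"
    "\<And>X. congruent2 P X \<Longrightarrow> \<exists>z. ball z r \<subseteq> X \<and> X \<subseteq> cball z D"
proof -
  obtain c r where r: "r > 0" "ball c r \<subseteq> P"
    using assms(2) by (meson ex_in_conv mem_interior)
  obtain D where D: "P \<subseteq> cball c D"
    using assms(1) bounded_any_center[of P c] by (auto simp: subset_iff)
  have "ball (f c) r \<subseteq> f ` P \<and> f ` P \<subseteq> cball (f c) D" if f: "isometry2 f" for f
  proof
    obtain L where L: "orthogonal_transformation L" "f = (\<lambda>x. f 0 + L x)"
      using isometry2_affine[OF f] .
    show "ball (f c) r \<subseteq> f ` P"
    proof
      fix y assume y: "y \<in> ball (f c) r"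
      obtain x where "L x = y - f 0"
        using orthogonal_transformation_surj[OF L(1)] by (metis surjD)
      then have "y = f x" by (subst L(2)) simp
      then have "x \<in> ball c r" using y f by (simp add: isometry2_def)
      then show "y \<in> f ` P" using \<open>y = f x\<close> r by blast
    qed
    show "f ` P \<subseteq> cball (f c) D"
      using D f by (auto simp: isometry2_def)
  qed
  then show ?thesis using that r(1) unfolding congruent2_def by metis
qed

section \<open>Tiles as pentagons and local finiteness\<close>

locale pentagon_tiling =
  fixes s :: real and p :: "nat \<Rightarrow> real^2" and T :: "(real^2) set set"
  assumes oriented: "oriented_pentagon s p"
    and monohedral: "monohedral_tiling_by (pentagon_region p) T"
begin

lemma tile_closed: "X \<in> T \<Longrightarrow> closed X"
  and tiles_cover: "\<Union>T = UNIV"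
  and tiles_disjoint: "X \<in> T \<Longrightarrow> Y \<in> T \<Longrightarrow> X \<noteq> Y \<Longrightarrow> interior X \<inter> interior Y = {}"
  and tile_congruent: "X \<in> T \<Longrightarrow> congruent2 (pentagon_region p) X"
  using monohedral by (auto simp: monohedral_tiling_by_def tiling_def)

lemma tile_pentagon:
  assumes "X \<in> T"
  obtains s' q where "oriented_pentagon s' q" "X = pentagon_region q"
    "\<And>i. corner_angle q i = corner_angle p i"
  using congruent_pentagon[OF oriented tile_congruent[OF assms]] by metis

lemma tile_convex: "X \<in> T \<Longrightarrow> convex X"
  by (metis tile_pentagon convex_convex_hull pentagon_region_def)

lemma tile_interior: "X \<in> T \<Longrightarrow> interior X \<noteq> {}"
  by (metis tile_pentagon pentagon_corner(4) zero_less_numeral)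

text \<open>Tiles that meet \<open>B\<close> have the centres of their inscribed balls in a fixed
  disc, which is covered by finitely many balls of radius \<open>r\<close>. A net point within
  \<open>r\<close> of the centre is interior to the tile, so distinct tiles get distinct net
  points.\<close>

lemma finite_tiles_meeting:
  assumes "bounded B"
  shows "finite {X \<in> T. X \<inter> B \<noteq> {}}"
proof -
  have "bounded (pentagon_region p)"
    unfolding pentagon_region_def by (intro bounded_convex_hull finite_imp_bounded) auto
  moreover have "interior (pentagon_region p) \<noteq> {}"
    using pentagon_corner(4)[OF oriented, of 0] by simp
  ultimately obtain r D where r: "r > 0"
    and "\<And>X. congruent2 (pentagon_region p) X \<Longrightarrow> \<exists>z. ball z r \<subseteq> X \<and> X \<subseteq> cball z D"
    using congruent_uniform_balls by metis
  then obtain z where z: "\<And>X. X \<in> T \<Longrightarrow> ball (z X) r \<subseteq> X \<and> X \<subseteq> cball (z X) D"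
    using tile_congruent by metis
  obtain M where M: "B \<subseteq> cball 0 M"
    using assms bounded_any_center[of B 0] by (auto simp: subset_iff)
  have "compact (cball (0::real^2) (M + D))" by simp
  then obtain N where N: "finite N" "cball (0::real^2) (M + D) \<subseteq> (\<Union>n\<in>N. ball n r)"
    using r unfolding compact_eq_totally_bounded by meson
  define Q where "Q = {X \<in> T. X \<inter> B \<noteq> {}}"
  have near: "\<exists>n. n \<in> N \<and> dist (z X) n < r" if X: "X \<in> Q" for X
  proof -
    obtain b where "b \<in> X" "b \<in> B" "X \<in> T" using X by (auto simp: Q_def)
    then have "b \<in> cball (z X) D" "b \<in> cball 0 M" using z M by blast+
    then have "dist (z X) b \<le> D" "dist 0 b \<le> M" by simp_all
    then have "dist 0 (z X) \<le> M + D"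
      using dist_triangle[of 0 "z X" b] by (simp add: dist_commute)
    then have "z X \<in> (\<Union>n\<in>N. ball n r)" using N(2) by (auto simp only: mem_cball)
    then show ?thesis by (auto simp: dist_commute)
  qed
  obtain g where g: "\<forall>X\<in>Q. g X \<in> N \<and> dist (z X) (g X) < r"
    using bchoice[of Q "\<lambda>X n. n \<in> N \<and> dist (z X) n < r"] near by blast
  have gi: "X \<in> T" "g X \<in> interior X" if "X \<in> Q" for X
  proof -
    show "X \<in> T" using that by (simp add: Q_def)
    then have "ball (z X) r \<subseteq> interior X" using z by (intro interior_maximal) auto
    moreover have "g X \<in> ball (z X) r" using g that by simp
    ultimately show "g X \<in> interior X" by blast
  qed
  have "inj_on g Q"
  proof (rule inj_onI)
    fix X Y assume "X \<in> Q" "Y \<in> Q" "g X = g Y"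
    then show "X = Y" using gi[of X] gi[of Y] tiles_disjoint[of X Y] by auto
  qed
  moreover have "g ` Q \<subseteq> N" using g by blast
  ultimately have "finite Q" using N(1) by (rule inj_on_finite)
  then show ?thesis by (simp add: Q_def)
qed

lemma finite_tiles_at: "finite {X \<in> T. x \<in> X}"
  using finite_tiles_meeting[of "{x}"] by simp

text \<open>By local finiteness the tiles avoiding \<open>x\<close> stay away from a ball around
  \<open>x\<close>. A short enough step along \<open>d\<close> therefore ends in a tile that
  contains \<open>x\<close>.\<close>

lemma tangent_cones_cover: "\<exists>X\<in>T. x \<in> X \<and> d \<in> tangent_cone X x"
proof -
  define F where "F = {X \<in> T. X \<inter> cball x 1 \<noteq> {}}"
  have "finite F" unfolding F_def by (intro finite_tiles_meeting) auto
  then have "closed (\<Union>{X \<in> F. x \<notin> X})"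
    by (intro closed_Union finite_Collect_conjI) (auto simp: F_def tile_closed)
  then have "open (- \<Union>{X \<in> F. x \<notin> X})" by (rule open_Compl)
  then obtain r where r: "r > 0" "ball x r \<subseteq> - \<Union>{X \<in> F. x \<notin> X}"
    by (rule openE[where x = x]) auto
  \<comment> \<open>The bound 1 keeps the end point in the disc that defines \<open>F\<close>, and
    \<open>norm d + 1\<close> is positive even for \<open>d = 0\<close>.\<close>
  define e where "e = min r 1 / (2 * (norm d + 1))"
  have "e > 0" using r by (auto simp: e_def intro!: divide_pos_pos add_nonneg_pos)
  have "e * norm d \<le> e * (norm d + 1)" using \<open>e > 0\<close> by simp
  also have "\<dots> = min r 1 / 2"
    using norm_ge_zero[of d] by (simp add: e_def field_simps add_nonneg_eq_0_iff)
  also have "\<dots> < min r 1" using r(1) by auto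
  finally have e: "e * norm d < min r 1" .
  obtain X where X: "X \<in> T" "x + e *\<^sub>R d \<in> X" using tiles_cover by blast
  have "x + e *\<^sub>R d \<in> ball x r" "x + e *\<^sub>R d \<in> cball x 1"
    using e \<open>e > 0\<close> by (auto simp: dist_norm)
  moreover from this have "X \<in> F" using X unfolding F_def by blast
  ultimately have "x \<in> X" using X r(2) by blast
  then show ?thesis using X \<open>e > 0\<close> by (auto simp: tangent_cone_def)
qed

section \<open>Angles of the tiles around a point\<close>

definition corners :: "(real^2) set \<Rightarrow> (real^2) set" where
  "corners X = {x. x extreme_point_of X}"

text \<open>Like \<open>corners\<close>, this depends only on the set and the point, so no cyclic
  list of corners has to be chosen for a tile.\<close>

definition angle_at :: "(real^2) set \<Rightarrow> real^2 \<Rightarrow> real" where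
  "angle_at X x = cone_angle (tangent_cone X x)"

lemma corners_subset: "corners X \<subseteq> X"
  by (auto simp: corners_def extreme_point_of_def)

lemma angle_at_corner:
  assumes "X \<in> T" "x \<in> corners X"
  shows "directions_in (tangent_cone X x) \<in> lmeasurable"
    "\<exists>i<5. angle_at X x = corner_angle p i"
    "0 < angle_at X x" "angle_at X x < pi"
proof -
  obtain t q where q: "oriented_pentagon t q" "X = pentagon_region q"
    "\<And>i. corner_angle q i = corner_angle p i" using tile_pentagon[OF assms(1)] by metis
  obtain i where i: "i < 5" "x = q i"
    using assms(2) extreme_points_pentagon_region[OF q(1)] by (auto simp: corners_def q(2))
  show "directions_in (tangent_cone X x) \<in> lmeasurable"
    "\<exists>i<5. angle_at X x = corner_angle p i"
    "0 < angle_at X x" "angle_at X x < pi"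
    using cone_angle_corner[OF q(1) i(1)] i q(2,3) by (auto simp: angle_at_def)
qed

lemma angle_at_not_corner:
  assumes "X \<in> T" "x \<in> X" "x \<notin> corners X"
  shows "directions_in (tangent_cone X x) \<in> lmeasurable"
    "angle_at X x = pi \<or> angle_at X x = 2 * pi"
  using cone_angle_not_extreme[of X x] assms tile_convex tile_interior
  by (auto simp: angle_at_def corners_def)

lemma tile_angle_sum:
  assumes "X \<in> T"
  shows "card (corners X) = 5" "(\<Sum>x\<in>corners X. angle_at X x) = 3 * pi"
proof -
  obtain t q where q: "oriented_pentagon t q" "X = pentagon_region q"
    "\<And>i. corner_angle q i = corner_angle p i" using tile_pentagon[OF assms(1)] by metis
  have c: "corners X = q ` {..<5}"
    using extreme_points_pentagon_region[OF q(1)] by (simp add: corners_def q(2))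
  note inj = inj_on_pentagon[OF q(1)]
  show "card (corners X) = 5" unfolding c by (simp add: card_image inj)
  show "(\<Sum>x\<in>corners X. angle_at X x) = 3 * pi"
    unfolding c sum.reindex[OF inj] using pentagon_angle_sum[OF q(1)] cone_angle_corner(2)[OF q(1)]
    by (simp add: angle_at_def q(2))
qed

text \<open>The tangent cones cover all directions. Two of them share only parallel vectors, as
  otherwise the interiors would meet, so the measures add up to a full turn.\<close>

lemma angle_sum_at_point: "(\<Sum>X | X \<in> T \<and> x \<in> X. angle_at X x) = 2 * pi"
proof -
  let ?R = "{X. X \<in> T \<and> x \<in> X}" and ?D = "\<lambda>X. directions_in (tangent_cone X x)"
  have "(\<Sum>X\<in>?R. measure lebesgue (?D X)) = measure lebesgue (\<Union>(?D ` ?R))"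
  proof (rule measure_negligible_finite_Union_image[symmetric])
    show "finite ?R" by (rule finite_tiles_at)
    show "?D X \<in> lmeasurable" if "X \<in> ?R" for X
      using that angle_at_corner(1) angle_at_not_corner(1) by blast
    show "pairwise (\<lambda>X Y. negligible (?D X \<inter> ?D Y)) ?R"
    proof (rule pairwiseI)
      fix X Y assume XY: "X \<in> ?R" "Y \<in> ?R" "X \<noteq> Y"
      have "?D X \<inter> ?D Y = directions_in (tangent_cone X x \<inter> tangent_cone Y x)"
        by (auto simp: directions_in_def)
      moreover have "finite \<dots>"
      proof (rule finite_directions_in_line, rule ccontr)
        fix a b assume "a \<in> tangent_cone X x \<inter> tangent_cone Y x"
          "b \<in> tangent_cone X x \<inter> tangent_cone Y x" "cross2 a b \<noteq> 0"
        then show False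
          using interiors_meet[of X x a b Y] tiles_disjoint[of X Y] XY tile_convex by auto
      qed
      ultimately show "negligible (?D X \<inter> ?D Y)" by (simp add: negligible_finite)
    qed
  qed
  also have "\<Union>(?D ` ?R) = directions_in UNIV"
  proof
    show "directions_in UNIV \<subseteq> \<Union>(?D ` ?R)"
    proof
      fix t assume t: "t \<in> directions_in UNIV"
      obtain X where "X \<in> T" "x \<in> X" "direction t \<in> tangent_cone X x"
        using tangent_cones_cover by blast
      then have "X \<in> ?R" "t \<in> ?D X" using t by (simp_all add: directions_in_def)
      then show "t \<in> \<Union>(?D ` ?R)" by blast
    qed
  qed (auto simp: directions_in_def)
  finally show ?thesis using cone_angle_UNIV by (simp add: angle_at_def cone_angle_def)
qed

lemma corner_weight_nonpos:
  assumes no_triple: "\<And>i j k. i < 5 \<Longrightarrow> j < 5 \<Longrightarrow> k < 5 \<Longrightarrow>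
      corner_angle p i + corner_angle p j + corner_angle p k \<noteq> 2 * pi"
  shows "(\<Sum>X | X \<in> T \<and> x \<in> corners X. angle_at X x - pi / 2) \<le> 0"
proof -
  \<comment> \<open>\<open>R - S\<close> consists of the tiles that contain \<open>x\<close> without
    having a corner there; each takes up \<open>pi\<close> or \<open>2 * pi\<close>.\<close>
  define R where "R = {X. X \<in> T \<and> x \<in> X}"
  define S where "S = {X. X \<in> T \<and> x \<in> corners X}"
  have "S \<subseteq> R" using corners_subset by (auto simp: S_def R_def)
  have finR: "finite R" unfolding R_def by (rule finite_tiles_at)
  have fin: "finite S" "finite (R - S)" using finR \<open>S \<subseteq> R\<close> finite_subset by auto
  have total: "sum (\<lambda>X. angle_at X x) (R - S) + sum (\<lambda>X. angle_at X x) S = 2 * pi"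
    using angle_sum_at_point[of x] sum.subset_diff[OF \<open>S \<subseteq> R\<close> finR] by (metis R_def)
  have S: "\<exists>i<5. angle_at X x = corner_angle p i" "0 < angle_at X x" "angle_at X x < pi"
    if "X \<in> S" for X
    using that angle_at_corner by (auto simp: S_def)
  have N: "angle_at X x = pi \<or> angle_at X x = 2 * pi" if "X \<in> R - S" for X
    using that angle_at_not_corner by (auto simp: S_def R_def)
  then have "(\<Sum>X\<in>R - S. pi) \<le> sum (\<lambda>X. angle_at X x) (R - S)"
    by (intro sum_mono) force
  then have lower: "of_nat (card (R - S)) * pi \<le> sum (\<lambda>X. angle_at X x) (R - S)" by simp
  have none: "sum (\<lambda>X. angle_at X x) (R - S) = 0" if "R - S = {}"
    unfolding that by simp
  have some: "sum (\<lambda>X. angle_at X x) (R - S) \<ge> pi" if "R - S \<noteq> {}"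
  proof -
    have "card (R - S) > 0" using fin(2) that card_gt_0_iff by blast
    then have "1 * pi \<le> real (card (R - S)) * pi" by (intro mult_right_mono) (linarith | rule pi_ge_zero)+
    then show ?thesis using lower by linarith
  qed
  have "(\<Sum>X\<in>S. angle_at X x - pi / 2) = sum (\<lambda>X. angle_at X x) S - card S * (pi / 2)"
    by (simp add: sum_subtractf)
  also have "\<dots> \<le> 0"
  proof -
    \<comment> \<open>With \<open>n\<close> corners at \<open>x\<close>, the claim is that their
      angles sum to at most \<open>n * pi / 2\<close>.\<close>
    consider "card S = 0" | "card S = 1" | "card S = 2" | "card S = 3" | "card S \<ge> 4"
      by linarith
    then show ?thesis
    proof cases
      case 1
      then show ?thesis using fin(1) by simp
    next
      case 2
      then obtain X where X: "S = {X}" by (rule card_1_singletonE)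
      then have sumS: "sum (\<lambda>X. angle_at X x) S = angle_at X x" by simp
      have X': "0 < angle_at X x" "angle_at X x < pi" using S X by auto
      \<comment> \<open>A single corner would leave strictly between \<open>pi\<close> and
        \<open>2 * pi\<close> to the other tiles, whose angles sum to 0, to \<open>pi\<close> or to
        at least \<open>2 * pi\<close>.\<close>
      have "card (R - S) = 0 \<or> card (R - S) = 1 \<or> card (R - S) \<ge> 2" by linarith
      then have False
      proof (elim disjE)
        assume "card (R - S) = 0"
        then have "R - S = {}" using fin(2) by (simp only: card_0_eq)
        then show ?thesis using none total sumS X' by linarith
      next
        assume "card (R - S) = 1"
        then obtain Y where Y: "R - S = {Y}" by (rule card_1_singletonE)
        then have "sum (\<lambda>X. angle_at X x) (R - S) = angle_at Y x" by simp
        moreover have "angle_at Y x = pi \<or> angle_at Y x = 2 * pi" using N Y by blast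
        ultimately show ?thesis using total sumS X' by linarith
      next
        assume "card (R - S) \<ge> 2"
        then have "2 * pi \<le> real (card (R - S)) * pi" by (intro mult_right_mono) (linarith | rule pi_ge_zero)+
        then show ?thesis using lower total sumS X' by linarith
      qed
      then show ?thesis ..
    next
      case 3
      show ?thesis
      proof (cases "R - S = {}")
        case True
        \<comment> \<open>Two angles below \<open>pi\<close> cannot fill \<open>2 * pi\<close>, so
          this case is contradictory.\<close>
        obtain X Y where XY: "S = {X, Y}" "X \<noteq> Y" using 3 by (auto simp: card_2_iff)
        then have "sum (\<lambda>X. angle_at X x) S = angle_at X x + angle_at Y x" by simp
        moreover have "angle_at X x < pi" "angle_at Y x < pi" using S XY by auto
        ultimately show ?thesis using none[OF True] total by linarith
      next
        case False
        have "real (card S) * (pi / 2) = pi" using 3 by simp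
        then show ?thesis using some[OF False] total by linarith
      qed
    next
      case 4
      show ?thesis
      proof (cases "R - S = {}")
        case True
        obtain X Y Z where XYZ: "S = {X, Y, Z}" "X \<noteq> Y" "Y \<noteq> Z" "X \<noteq> Z"
          using 4 by (auto simp: card_3_iff)
        then have sumS: "sum (\<lambda>X. angle_at X x) S = angle_at X x + angle_at Y x + angle_at Z x"
          by simp
        obtain i j k where "i < 5" "j < 5" "k < 5" "angle_at X x = corner_angle p i"
          "angle_at Y x = corner_angle p j" "angle_at Z x = corner_angle p k"
          using S(1)[of X] S(1)[of Y] S(1)[of Z] XYZ(1) by blast
        then have "corner_angle p i + corner_angle p j + corner_angle p k = 2 * pi"
          using sumS none[OF True] total by linarith
        then show ?thesis using no_triple \<open>i < 5\<close> \<open>j < 5\<close> \<open>k < 5\<close> by blast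
      next
        case False
        \<comment> \<open>A tile without a corner at \<open>x\<close> leaves at most
          \<open>pi\<close> for the three corners.\<close>
        have "real (card S) * (pi / 2) = 3 * pi / 2" using 4 by simp
        then show ?thesis using some[OF False] total pi_gt_zero by linarith
      qed
    next
      case 5
      then have "4 * (pi / 2) \<le> real (card S) * (pi / 2)" by (intro mult_right_mono) auto
      moreover have "0 \<le> real (card (R - S)) * pi" by simp
      ultimately show ?thesis using lower total by linarith
    qed
  qed
  finally show ?thesis by (simp add: S_def)
qed

end

section \<open>Periodic tilings\<close>

abbreviation shift :: "real^2 \<Rightarrow> (real^2) set \<Rightarrow> (real^2) set" where
  "shift l X \<equiv> (\<lambda>x. x + l) ` X"

lemma shift_shift: "shift a (shift b X) = shift (b + a) X"
  by (simp add: image_image add.assoc)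

lemma shift_cancel: "shift l (shift (- l) X) = X" "shift (- l) (shift l X) = X"
  by (simp_all add: image_image)

lemma tangent_cone_shift: "tangent_cone (shift l X) (x + l) = tangent_cone X x"
proof -
  have "x + l + w \<in> shift l X \<longleftrightarrow> x + w \<in> X" for w
    by (auto simp: image_iff algebra_simps)
  then show ?thesis by (simp add: tangent_cone_def)
qed

text \<open>The integer parts of the coordinates of \<open>x\<close> in the basis \<open>u\<close>,
  \<open>v\<close>, which Cramer's rule expresses as quotients of cross products.\<close>

definition lattice_part :: "real^2 \<Rightarrow> real^2 \<Rightarrow> real^2 \<Rightarrow> real^2" where
  "lattice_part u v x = of_int \<lfloor>cross2 x v / cross2 u v\<rfloor> *\<^sub>R u
     + of_int \<lfloor>cross2 u x / cross2 u v\<rfloor> *\<^sub>R v"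

definition lattice :: "real^2 \<Rightarrow> real^2 \<Rightarrow> (real^2) set" where
  "lattice u v = {of_int m *\<^sub>R u + of_int n *\<^sub>R v | m n. True}"

lemma lattice_part_in_lattice: "lattice_part u v x \<in> lattice u v"
  by (auto simp: lattice_part_def lattice_def)

lemma lattice_uminus: "l \<in> lattice u v \<Longrightarrow> - l \<in> lattice u v"
proof -
  assume "l \<in> lattice u v"
  then obtain m n where "l = of_int m *\<^sub>R u + of_int n *\<^sub>R v" by (auto simp: lattice_def)
  then have "- l = of_int (- m) *\<^sub>R u + of_int (- n) *\<^sub>R v" by simp
  then show ?thesis unfolding lattice_def by blast
qed

text \<open>A lattice vector changes both coordinates by integers, and \<open>floor\<close> commutes
  with adding integers. Hence subtracting its lattice part moves any point into the fundamental
  parallelogram.\<close>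

lemma lattice_part_add:
  assumes "cross2 u v \<noteq> 0" "l \<in> lattice u v"
  shows "lattice_part u v (x + l) = lattice_part u v x + l"
proof -
  obtain m n where l: "l = of_int m *\<^sub>R u + of_int n *\<^sub>R v"
    using assms(2) by (auto simp: lattice_def)
  have "cross2 (x + l) v / cross2 u v = cross2 x v / cross2 u v + of_int m"
    "cross2 u (x + l) / cross2 u v = cross2 u x / cross2 u v + of_int n"
    using assms(1) by (simp_all add: l cross2_simps add_divide_distrib)
  then show ?thesis
    by (simp add: lattice_part_def l scaleR_add_left)
qed

text \<open>The set is the half-open parallelogram spanned by \<open>u\<close> and \<open>v\<close>:
  its points are given by their fractional parts.\<close>

lemma bounded_fundamental_domain:
  assumes "cross2 u v \<noteq> 0"
  shows "bounded {x. lattice_part u v x = 0}"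
proof (rule boundedI)
  fix x assume x: "x \<in> {x. lattice_part u v x = 0}"
  let ?s = "cross2 x v / cross2 u v" and ?t = "cross2 u x / cross2 u v"
  have "x = (1 / cross2 u v) *\<^sub>R (cross2 u v *\<^sub>R x)" using assms by simp
  also have "\<dots> = ?s *\<^sub>R u + ?t *\<^sub>R v"
    by (subst cross2_decompose) (simp add: scaleR_add_right)
  also have "\<dots> = frac ?s *\<^sub>R u + frac ?t *\<^sub>R v + lattice_part u v x"
    by (simp add: frac_def lattice_part_def algebra_simps)
  finally have "x = frac ?s *\<^sub>R u + frac ?t *\<^sub>R v" using x by simp
  then have "norm x \<le> norm (frac ?s *\<^sub>R u) + norm (frac ?t *\<^sub>R v)"
    by (metis norm_triangle_ineq)
  also have "\<dots> \<le> 1 * norm u + 1 * norm v"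
    unfolding norm_scaleR using frac_lt_1 frac_ge_0
    by (intro add_mono mult_right_mono) (auto intro: less_imp_le)
  finally show "norm x \<le> norm u + norm v" by simp
qed

lemma independent_imp_cross2_nonzero:
  assumes "u \<noteq> v" "independent {u, v}"
  shows "cross2 u v \<noteq> 0"
proof
  assume c: "cross2 u v = 0"
  have "v \<noteq> 0" using assms(2) dependent_zero by blast
  \<comment> \<open>For parallel vectors, \<open>u\<close> equals its projection onto
    \<open>v\<close>.\<close>
  have "(v \<bullet> v) *\<^sub>R u = (u \<bullet> v) *\<^sub>R v"
    using c by (simp add: vec_eq_iff forall_2 inner2 cross2_def algebra_simps)
  then have "u = ((u \<bullet> v) / (v \<bullet> v)) *\<^sub>R v"
    using \<open>v \<noteq> 0\<close> by (metis divideR_right divide_inverse inner_eq_zero_iff mult.commute scaleR_scaleR)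
  then have "u \<in> span {v}" by (metis span_base span_scale singletonI)
  moreover have "{u, v} - {u} = {v}" using assms(1) by auto
  ultimately show False using assms(2) by (auto simp: dependent_def)
qed

text \<open>Invariance is an equality of sets of tiles, so it also provides the shift by
  \<open>- u\<close>, and integer induction can run in both directions.\<close>

lemma shift_multiples:
  assumes inv: "shift u ` T = T" and X: "X \<in> T"
  shows "shift (of_int m *\<^sub>R u) X \<in> T"
proof -
  have up: "shift u Y \<in> T" if "Y \<in> T" for Y using that inv by blast
  have down: "shift (- u) Y \<in> T" if Y: "Y \<in> T" for Y
  proof -
    have "Y \<in> shift u ` T" using Y inv by simp
    then obtain Z where "Z \<in> T" "Y = shift u Z" by (rule imageE)
    then show ?thesis by (simp only: shift_cancel)
  qed
  show ?thesis
  proof (induction m rule: int_induct[where k = 0])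
    case base
    then show ?case using X by simp
  next
    case (step1 i)
    then show ?case using up[OF step1(2)] by (simp add: image_image algebra_simps)
  next
    case (step2 i)
    then show ?case using down[OF step2(2)] by (simp add: image_image algebra_simps)
  qed
qed

lemma shift_lattice:
  assumes "shift u ` T = T" "shift v ` T = T" "X \<in> T" "l \<in> lattice u v"
  shows "shift l X \<in> T"
proof -
  obtain m n where l: "l = of_int m *\<^sub>R u + of_int n *\<^sub>R v"
    using assms(4) by (auto simp: lattice_def)
  show ?thesis
    using shift_multiples[OF assms(2) shift_multiples[OF assms(1,3), of m], of n]
    by (simp only: shift_shift l)
qed

section \<open>Double counting of the corner weights modulo the period lattice\<close>

context pentagon_tiling
begin

lemma corners_shift: "corners (shift l X) = shift l (corners X)"
  using extreme_points_of_translation[of l X] by (simp add: corners_def add.commute)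

text \<open>A reference point that moves along with the tile under translations. Its lattice part
  singles out one representative in each class of tiles modulo the lattice.\<close>

definition centroid :: "(real^2) set \<Rightarrow> real^2" where
  "centroid X = (1 / 5) *\<^sub>R (\<Sum>x\<in>corners X. x)"

lemma centroid_shift:
  assumes "X \<in> T"
  shows "centroid (shift l X) = centroid X + l"
proof -
  have "(\<Sum>x\<in>corners (shift l X). x) = (\<Sum>x\<in>corners X. x + l)"
    unfolding corners_shift by (simp add: sum.reindex)
  also have "\<dots> = (\<Sum>x\<in>corners X. x) + 5 *\<^sub>R l"
    using tile_angle_sum(1)[OF assms] by (simp add: sum.distrib sum_constant_scaleR del: sum_constant)
  finally show ?thesis by (simp add: centroid_def scaleR_add_right)
qed

lemma angle_at_shift: "angle_at (shift l X) (x + l) = angle_at X x"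
  by (simp add: angle_at_def tangent_cone_shift)

lemma periodic_corner_triple:
  assumes inv: "shift u ` T = T" "shift v ` T = T" and uv: "cross2 u v \<noteq> 0"
  shows "\<exists>i<5. \<exists>j<5. \<exists>k<5. corner_angle p i + corner_angle p j + corner_angle p k = 2 * pi"
proof (rule ccontr)
  assume "\<not> ?thesis"
  then have no_triple: "corner_angle p i + corner_angle p j + corner_angle p k \<noteq> 2 * pi"
    if "i < 5" "j < 5" "k < 5" for i j k using that by blast
  let ?f = "lattice_part u v"
  let ?w = "\<lambda>(X, c). angle_at X c - pi / 2"
  \<comment> \<open>\<open>A\<close> and \<open>B\<close> both represent the pairs of a tile and one
    of its corners modulo the lattice: \<open>A\<close> normalizes the position of the corner,
    \<open>B\<close> that of the tile. The maps \<open>i\<close> and \<open>j\<close> translate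
    between the two choices.\<close>
  define A where "A = {(X, c). X \<in> T \<and> c \<in> corners X \<and> ?f c = 0}"
  define B where "B = {(X, c). X \<in> T \<and> c \<in> corners X \<and> ?f (centroid X) = 0}"
  define i where "i = (\<lambda>(X, c). (shift (- ?f c) X, c + - ?f c))"
  define j where "j = (\<lambda>(X, c::real^2). (shift (- ?f (centroid X)) X, c + - ?f (centroid X)))"
  have f_sub: "?f (x + - ?f y) = ?f x - ?f y" for x y
    using lattice_part_add[OF uv lattice_uminus[OF lattice_part_in_lattice]] by simp
  have shT: "shift (- ?f y) X \<in> T" if "X \<in> T" for X y
    using shift_lattice[OF inv that lattice_uminus[OF lattice_part_in_lattice]] .
  have corner: "c + l \<in> corners (shift l X) \<longleftrightarrow> c \<in> corners X" for c l X
    unfolding corners_shift by auto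
  have ij: "i (j a) = a" "j a \<in> B" if "a \<in> A" for a
    using that by (auto simp: A_def B_def i_def j_def f_sub shT corner centroid_shift image_image
        simp del: add_uminus_conv_diff)
  have ji: "j (i b) = b" "i b \<in> A" if "b \<in> B" for b
    using that by (auto simp: A_def B_def i_def j_def f_sub shT corner centroid_shift image_image
        simp del: add_uminus_conv_diff)
  \<comment> \<open>Weights are invariant under translation, so the two total weights agree.\<close>
  have w: "?w (j a) = ?w a" if "a \<in> A" for a
    by (auto simp: j_def angle_at_shift split: prod.splits simp del: add_uminus_conv_diff)
  have AB: "sum ?w A = sum ?w B"
    by (rule sum.reindex_bij_witness[where i = i and j = j]) (use ij ji w in auto)

  have fin_corners: "finite (corners X)" if "X \<in> T" for X
    using tile_angle_sum(1)[OF that] card_ge_0_finite by force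
  have "finite A"
  proof (rule finite_subset)
    let ?F = "{X \<in> T. X \<inter> {x. ?f x = 0} \<noteq> {}}"
    show "A \<subseteq> Sigma ?F corners" using corners_subset by (auto simp: A_def)
    show "finite (Sigma ?F corners)"
      using finite_tiles_meeting[OF bounded_fundamental_domain[OF uv]] fin_corners
      by (intro finite_SigmaI) auto
  qed
  \<comment> \<open>Membership in \<open>A\<close> restricts only the position of the corner, so
    every point of \<open>C\<close> brings along all tiles with a corner there and the bound at a
    single point applies.\<close>
  define C where "C = snd ` A"
  let ?S = "SIGMA c:C. {X. X \<in> T \<and> c \<in> corners X}"
  have A: "A = (\<lambda>(c, X). (X, c)) ` ?S"
    by (force simp: A_def C_def)
  have inj: "inj_on (\<lambda>(c, X). (X, c)) ?S"
    by (auto simp: inj_on_def)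
  have "sum ?w A = sum ?w ((\<lambda>(c, X). (X, c)) ` ?S)"
    by (rule arg_cong[OF A])
  also have "\<dots> = sum (?w \<circ> (\<lambda>(c, X). (X, c))) ?S"
    by (rule sum.reindex[OF inj])
  also have "\<dots> = (\<Sum>c\<in>C. \<Sum>X | X \<in> T \<and> c \<in> corners X. angle_at X c - pi / 2)"
  proof (subst sum.Sigma)
    show "finite C" using \<open>finite A\<close> by (simp add: C_def)
    have "{X. X \<in> T \<and> c \<in> corners X} \<subseteq> {X \<in> T. c \<in> X}" for c using corners_subset by blast
    then show "\<forall>c\<in>C. finite {X. X \<in> T \<and> c \<in> corners X}"
      using finite_tiles_at finite_subset by blast
  qed (auto intro!: sum.cong)
  also have "\<dots> \<le> 0"
    by (rule sum_nonpos) (rule corner_weight_nonpos[OF no_triple])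
  finally have "sum ?w A \<le> 0" .

  \<comment> \<open>Membership in \<open>B\<close> restricts only the tile, so every tile of
    \<open>G\<close> contributes all five corners.\<close>
  define G where "G = {X \<in> T. ?f (centroid X) = 0}"
  have "B = Sigma G corners" by (auto simp: B_def G_def)
  have ne: "corners X \<noteq> {}" if "X \<in> T" for X using tile_angle_sum(1)[OF that] by auto
  have "B \<subseteq> j ` A"
  proof
    fix b assume "b \<in> B"
    then show "b \<in> j ` A" using ji[of b] by (metis imageI)
  qed
  then have "finite B" using \<open>finite A\<close> finite_surj by blast
  moreover have "G = fst ` B" using ne unfolding \<open>B = Sigma G corners\<close> by (force simp: G_def)
  ultimately have "finite G" by simp
  have "sum ?w B = (\<Sum>X\<in>G. \<Sum>c\<in>corners X. angle_at X c - pi / 2)"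
    unfolding \<open>B = Sigma G corners\<close> using \<open>finite G\<close> fin_corners
    by (subst sum.Sigma) (auto simp: G_def)
  \<comment> \<open>The total weight of a tile is \<open>3 * pi - 5 * (pi / 2)\<close>.\<close>
  also have "\<dots> = (\<Sum>X\<in>G. pi / 2)"
    using tile_angle_sum by (intro sum.cong) (auto simp: G_def sum_subtractf)
  finally have B: "sum ?w B = card G * (pi / 2)" by simp
  \<comment> \<open>Some translate of any tile lies in \<open>G\<close>, so the total weight is
    strictly positive, against the bound from \<open>A\<close>.\<close>
  obtain X where "X \<in> T" using tiles_cover by blast
  then have "shift (- ?f (centroid X)) X \<in> G"
    using shT centroid_shift f_sub by (auto simp: G_def simp del: add_uminus_conv_diff)
  then have "card G > 0" using \<open>finite G\<close> card_gt_0_iff by blast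
  then have "real (card G) * (pi / 2) > 0" by simp
  then show False using AB B \<open>sum ?w A \<le> 0\<close> by linarith
qed

end

theorem theorem1:
  fixes p :: "nat \<Rightarrow> real^2"
  assumes "convex_pentagon p"
    and "\<exists>T. monohedral_tiling_by (pentagon_region p) T \<and> periodic_tiling T"
  shows "\<exists>i<5. \<exists>j<5. \<exists>k<5.
           interior_angle_deg p i + interior_angle_deg p j + interior_angle_deg p k = 360"
proof -
  obtain s where "oriented_pentagon s p"
    using convex_pentagon_imp_oriented[OF assms(1)] .
  moreover obtain T u v where T: "monohedral_tiling_by (pentagon_region p) T"
    "u \<noteq> v" "independent {u, v}" "shift u ` T = T" "shift v ` T = T"
    using assms(2) by (auto simp: periodic_tiling_def)
  ultimately interpret pentagon_tiling s p T by unfold_locales auto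
  obtain i j k where ijk: "i < 5" "j < 5" "k < 5"
    and sum: "corner_angle p i + corner_angle p j + corner_angle p k = 2 * pi"
    using periodic_corner_triple[OF T(4,5) independent_imp_cross2_nonzero[OF T(2,3)]] by blast
  have "interior_angle_deg p i + interior_angle_deg p j + interior_angle_deg p k
      = (corner_angle p i + corner_angle p j + corner_angle p k) * 180 / pi"
    by (simp add: interior_angle_deg_eq add_divide_distrib distrib_right)
  also have "\<dots> = 360" unfolding sum by simp
  finally show ?thesis using ijk by blast
qed

end
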